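(* Let $b=\{b_I\}_{I\in\mathcal D}$ and $d=\{d_I\}_{I\in\mathcal D}$ be sequences of complex numbers indexed by the dyadic intervals, and let $b\circ d=\{b_Id_I\}_{I\in\mathcal D}$ be their Schur product. The composition $\mathsf P_b^{(1,0)}\circ\mathsf P_d^{(0,1)}$ is bounded on $L^2(\mathbb R)$ if and only if $\|\widehat S(b\circ d)\|_{CM}<\infty$ and $\|E(b\circ d)\|_{\ell^\infty}<\infty$. Moreover, the operator norm of the composition $\mathsf P_b^{(1,0)}\circ\mathsf P_d^{(0,1)}$ on $L^2(\mathbb R)$ satisfies $$\left\|\mathsf P_b^{(1,0)}\circ\mathsf P_d^{(0,1)}\right\|_{L^2(\mathbb R)\to L^2(\mathbb R)}=\left\|\mathsf P_{b\circ d}^{(1,1)}\right\|_{L^2(\mathbb R)\to L^2(\mathbb R)}\approx\left\|\widehat S(b\circ d)\right\|_{CM}+\left\|E(b\circ d)\right\|_{\ell^\infty}.$$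
   Context: $\mathcal D$ is the usual grid of dyadic intervals on $\mathbb R$; $I_-$ and $I_+$ are the left and right halves of $I$; $J\subset I$ allows $J=I$. For $I\in\mathcal D$, $h_I=h_I^0=|I|^{-1/2}(-\mathbf 1_{I_-}+\mathbf 1_{I_+})$ and $h_I^1=|I|^{-1}\mathbf 1_I$. For a complex sequence $b=\{b_I\}_{I\in\mathcal D}$ and $(\alpha,\beta)\in\{0,1\}\times\{0,1\}$, the dyadic paraproduct acting on a function $f$ is $$\mathsf P_b^{(\alpha,\beta)}f=\sum_{I\in\mathcal D}b_I\langle f,h_I^\beta\rangle_{L^2(\mathbb R)}h_I^\alpha .$$ For a sequence $a=\{a_I\}_{I\in\mathcal D}$: $\|a\|_{\ell^\infty}=\sup_{I\in\mathcal D}|a_I|$ and $\|a\|_{CM}=\Big(\sup_{I\in\mathcal D}\frac1{|I|}\sum_{J\subset I}|a_J|^2\Big)^{1/2}$. The sweep $\widehat S(a)$ and the sequence $E(a)$ are $$\widehat S(a)=\Big\{\Big\langle\sum_{J\in\mathcal D}a_Jh_J^1,h_I\Big\rangle_{L^2(\mathbb R)}\Big\}_{I\in\mathcal D}=\Big\{\sum_{J\subsetneq I}a_J\langle h_J^1,h_I\rangle_{L^2(\mathbb R)}\Big\}_{I\in\mathcal D},\qquad E(a)=\Big\{\frac1{|J|}\sum_{I\subset J}a_I\Big\}_{J\in\mathcal D}.$$ $A\approx B$ means $cB\le A\le CB$ with absolute constants $0<c\le C<\infty$. *)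

theory Defs
  imports "HOL-Analysis.Analysis" "HOL-Library.Z2"
begin

subsection \<open>Dyadic intervals and Haar functions\<close>

definition dyadic :: "real set set" where
  "dyadic = {{of_int m * 2 powi k ..< (of_int m + 1) * 2 powi k} | m k :: int. True}"

abbreviation len :: "real set \<Rightarrow> real" where
  "len I \<equiv> measure lborel I"

definition left_half :: "real set \<Rightarrow> real set" where
  "left_half I = {x \<in> I. x < (Inf I + Sup I) / 2}"

definition right_half :: "real set \<Rightarrow> real set" where
  "right_half I = {x \<in> I. (Inf I + Sup I) / 2 \<le> x}"

text \<open>The superscript ranges over the two-element type \<open>bit\<close>.\<close>

definition haar :: "bit \<Rightarrow> real set \<Rightarrow> real \<Rightarrow> complex" where
  "haar \<alpha> I x = complex_of_real
     (if \<alpha> = 0 then (indicator (right_half I) x - indicator (left_half I) x) / sqrt (len I)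
      else indicator I x / len I)"

definition haar_span :: "(real \<Rightarrow> complex) set" where
  "haar_span = {f. \<exists>F c. finite F \<and> F \<subseteq> dyadic \<and> f = (\<lambda>x. \<Sum>I\<in>F. c I * haar 0 I x)}"

subsection \<open>The space of square integrable functions and its bounded operators\<close>

definition L2 :: "(real \<Rightarrow> complex) set" where
  "L2 = {f \<in> borel_measurable lborel. integrable lborel (\<lambda>x. (cmod (f x))\<^sup>2)}"

definition L2_inner :: "(real \<Rightarrow> complex) \<Rightarrow> (real \<Rightarrow> complex) \<Rightarrow> complex" where
  "L2_inner f g = (LINT x|lborel. f x * cnj (g x))"

definition L2_norm :: "(real \<Rightarrow> complex) \<Rightarrow> real" where
  "L2_norm f = sqrt (LINT x|lborel. (cmod (f x))\<^sup>2)"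

text \<open>Linearity only holds almost everywhere, because elements of \<open>L2\<close> are functions rather than
  classes of functions; together with the norm bound it makes \<open>T\<close> respect equality almost
  everywhere.\<close>

definition L2_bounded_linear :: "((real \<Rightarrow> complex) \<Rightarrow> real \<Rightarrow> complex) \<Rightarrow> real \<Rightarrow> bool" where
  "L2_bounded_linear T C \<longleftrightarrow>
     (\<forall>f\<in>L2. T f \<in> L2 \<and> L2_norm (T f) \<le> C * L2_norm f) \<and>
     (\<forall>f\<in>L2. \<forall>g\<in>L2. \<forall>c. AE x in lborel. T (\<lambda>y. c * f y + g y) x = c * T f x + T g x)"

subsection \<open>Paraproducts\<close>

text \<open>For an arbitrary symbol \<open>b\<close> the series \<open>\<Sum>I. b\<^sub>I \<langle>f, h\<^sub>I\<^sup>\<beta>\<rangle> h\<^sub>I\<^sup>\<alpha>\<close> need not converge to a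
  function, and in a composition the inner series may leave \<open>L2\<close> although the composition is
  bounded. The series is therefore read weakly. A generalised function is represented by its
  pairings \<open>u \<phi> = \<langle>u, \<phi>\<rangle>\<close>, a function \<open>f\<close> being represented by \<open>L2_inner f\<close>, and
  \<open>paraproduct b \<alpha> \<beta> u v\<close> says that the series obtained from \<open>u\<close> converges unconditionally to \<open>v\<close>
  when paired with any finite linear combination of Haar functions.
  It is a relation, so that divergence of the series is visible.\<close>

type_synonym gen_fun = "(real \<Rightarrow> complex) \<Rightarrow> complex"

definition paraproduct ::
    "(real set \<Rightarrow> complex) \<Rightarrow> bit \<Rightarrow> bit \<Rightarrow> gen_fun \<Rightarrow> gen_fun \<Rightarrow> bool" where
  "paraproduct b \<alpha> \<beta> u v \<longleftrightarrow>
     (\<forall>\<phi>\<in>haar_span.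
        ((\<lambda>I. b I * u (haar \<beta> I) * L2_inner (haar \<alpha> I) \<phi>) has_sum v \<phi>) dyadic)"

definition composition ::
    "(gen_fun \<Rightarrow> gen_fun \<Rightarrow> bool) \<Rightarrow> (gen_fun \<Rightarrow> gen_fun \<Rightarrow> bool) \<Rightarrow> gen_fun \<Rightarrow> gen_fun \<Rightarrow> bool" where
  "composition P Q u v \<longleftrightarrow> (\<exists>w. Q u w \<and> P w v)"

text \<open>\<open>realizes T P\<close>: the operator \<open>T\<close> on \<open>L2\<close> extends \<open>P\<close> from the finite linear combinations of
  Haar functions. These are dense in \<open>L2\<close>, so a bounded extension is unique almost everywhere.
  Convergence of the series for every \<open>f \<in> L2\<close> cannot be demanded: a bounded composition may owe
  its boundedness to cancellation in the symbol, and its series may then fail to converge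
  unconditionally for some \<open>f\<close>.\<close>

definition realizes ::
    "((real \<Rightarrow> complex) \<Rightarrow> real \<Rightarrow> complex) \<Rightarrow> (gen_fun \<Rightarrow> gen_fun \<Rightarrow> bool) \<Rightarrow> bool" where
  "realizes T P \<longleftrightarrow> (\<forall>f\<in>haar_span. P (L2_inner f) (L2_inner (T f)))"

definition bounded_on_L2 :: "(gen_fun \<Rightarrow> gen_fun \<Rightarrow> bool) \<Rightarrow> bool" where
  "bounded_on_L2 P \<longleftrightarrow> (\<exists>T C. L2_bounded_linear T C \<and> realizes T P)"

text \<open>The value is \<open>\<infinity>\<close>, the infimum of the empty set, if \<open>P\<close> is not bounded.\<close>

definition L2_op_norm :: "(gen_fun \<Rightarrow> gen_fun \<Rightarrow> bool) \<Rightarrow> ennreal" where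
  "L2_op_norm P = Inf {ennreal C | C. 0 \<le> C \<and> (\<exists>T. L2_bounded_linear T C \<and> realizes T P)}"

subsection \<open>Sequences indexed by dyadic intervals\<close>

text \<open>The entries of the sweep and of \<open>E\<close> are infinite series; an entry is \<open>None\<close> if its series does
  not converge (unconditionally, the index set being unordered), and then its absolute value
  counts as \<open>\<infinity>\<close>.\<close>

definition series :: "('i \<Rightarrow> complex) \<Rightarrow> 'i set \<Rightarrow> complex option" where
  "series f A = (if f summable_on A then Some (infsum f A) else None)"

definition abs_entry :: "complex option \<Rightarrow> ennreal" where
  "abs_entry z = (case z of None \<Rightarrow> \<infinity> | Some w \<Rightarrow> ennreal (cmod w))"

definition sweep :: "(real set \<Rightarrow> complex) \<Rightarrow> real set \<Rightarrow> complex option" where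
  "sweep a I = series (\<lambda>J. a J * L2_inner (haar 1 J) (haar 0 I)) {J \<in> dyadic. J \<subset> I}"

definition E_seq :: "(real set \<Rightarrow> complex) \<Rightarrow> real set \<Rightarrow> complex option" where
  "E_seq a J = map_option (\<lambda>s. s / complex_of_real (len J)) (series a {I \<in> dyadic. I \<subseteq> J})"

definition ennreal_sqrt :: "ennreal \<Rightarrow> ennreal" where
  "ennreal_sqrt x = (if x = \<infinity> then \<infinity> else ennreal (sqrt (enn2real x)))"

definition linf_norm :: "(real set \<Rightarrow> complex option) \<Rightarrow> ennreal" where
  "linf_norm s = (SUP I\<in>dyadic. abs_entry (s I))"

definition CM_norm :: "(real set \<Rightarrow> complex option) \<Rightarrow> ennreal" where
  "CM_norm s = ennreal_sqrt
     (SUP I\<in>dyadic. (\<Sum>\<^sub>\<infinity>J\<in>{J \<in> dyadic. J \<subseteq> I}. (abs_entry (s J))\<^sup>2) / ennreal (len I))"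

definition schur :: "(real set \<Rightarrow> complex) \<Rightarrow> (real set \<Rightarrow> complex) \<Rightarrow> real set \<Rightarrow> complex" where
  "schur b d = (\<lambda>I. b I * d I)"

end

theory Submission
  imports Defs
begin

text \<open>
  Since \<open>\<langle>h\<^sub>I, h\<^sub>J\<rangle> = \<delta>\<^sub>I\<^sub>J\<close>, the composition is the paraproduct \<open>P\<^sub>a\<^sup>(\<^sup>1\<^sup>,\<^sup>1\<^sup>)\<close> with \<open>a = b \<circ> d\<close>. With the sweep
  \<open>S\<close> of \<open>a\<close> and \<open>D\<^sub>I = |I|\<^sup>-\<^sup>1 \<Sum>K\<subset>I. a\<^sub>K\<close> (proper subintervals), its matrix in the Haar basis has the
  diagonal \<open>D\<^sub>I\<close> and, for \<open>J\<close> a proper subinterval of \<open>I\<close>, the entries \<open>S\<^sub>J h\<^sub>I(J)\<close> at \<open>(I, J)\<close> and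
  \<open>(J, I)\<close>. Hence it is the sum of \<open>P\<^sub>S\<^sup>(\<^sup>0\<^sup>,\<^sup>1\<^sup>)\<close>, a diagonal operator, and \<open>P\<^sub>S\<^sup>(\<^sup>1\<^sup>,\<^sup>0\<^sup>)\<close>, and the Carleson
  embedding theorem bounds the outer two by \<open>\<parallel>S\<parallel>\<^sub>C\<^sub>M\<close>. Conversely, Bessel's inequality for the image of
  the Haar function of the parent of \<open>I\<close> gives the Carleson condition of \<open>S\<close> on \<open>I\<close>. Finally \<open>D\<close> and
  \<open>E(a)\<close> are comparable modulo \<open>S\<close>, because \<open>E(a)\<close> takes the values \<open>D\<^sub>I \<plusminus> S\<^sub>I / \<surd>|I|\<close> on the two
  halves of \<open>I\<close>.
\<close>

subsection \<open>Dyadic intervals\<close>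

definition dyad :: "int \<Rightarrow> int \<Rightarrow> real set" where
  "dyad m k = {of_int m * 2 powi k ..< (of_int m + 1) * 2 powi k}"

lemma dyadic_iff: "I \<in> dyadic \<longleftrightarrow> (\<exists>m k. I = dyad m k)"
  by (auto simp: dyadic_def dyad_def)

lemma dyad_in_dyadic [simp]: "dyad m k \<in> dyadic"
  by (auto simp: dyadic_iff)

text \<open>At each scale a point determines the index of its interval, so distinct intervals of one
  generation are disjoint; \<open>dyad_nested_le\<close> rests on this.\<close>

lemma mem_dyad_iff: "x \<in> dyad m k \<longleftrightarrow> \<lfloor>x / 2 powi k\<rfloor> = m"
  by (simp add: dyad_def floor_eq_iff field_simps)

lemma dyad_bounds_less: "real_of_int m * 2 powi k < (of_int m + 1) * 2 powi k"
  by simp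

lemma dyad_nonempty: "dyad m k \<noteq> {}"
  by (simp add: dyad_def)

lemma len_dyad: "len (dyad m k) = 2 powi k"
  using dyad_bounds_less[of m k] unfolding dyad_def
  by (subst measure_lborel_Ico) (auto simp: algebra_simps)

lemma powi_2_minus_1: "(2::real) powi k = 2 * 2 powi (k - 1)"
  using power_int_add_1[of "2::real" "k - 1"] by simp

lemma half_point_dyad: "(Inf (dyad m k) + Sup (dyad m k)) / 2 = (2 * of_int m + 1) * 2 powi (k - 1)"
  using dyad_bounds_less[of m k] powi_2_minus_1[of k] unfolding dyad_def
  by (simp add: algebra_simps)

lemma left_half_dyad: "left_half (dyad m k) = dyad (2 * m) (k - 1)"
  unfolding left_half_def half_point_dyad unfolding dyad_def powi_2_minus_1[of k]
  by (auto simp: algebra_simps)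

lemma right_half_dyad: "right_half (dyad m k) = dyad (2 * m + 1) (k - 1)"
  unfolding right_half_def half_point_dyad unfolding dyad_def powi_2_minus_1[of k]
  by (auto simp: algebra_simps)

lemma left_half_dyadic [simp, intro]: "I \<in> dyadic \<Longrightarrow> left_half I \<in> dyadic"
  by (metis dyadic_iff left_half_dyad)

lemma right_half_dyadic [simp, intro]: "I \<in> dyadic \<Longrightarrow> right_half I \<in> dyadic"
  by (metis dyadic_iff right_half_dyad)

lemma dyadic_nonempty: "I \<in> dyadic \<Longrightarrow> I \<noteq> {}"
  by (auto simp: dyadic_iff dyad_nonempty)

lemma len_pos [simp]: "I \<in> dyadic \<Longrightarrow> 0 < len I"
  by (auto simp: dyadic_iff len_dyad)

lemma len_left_half: "I \<in> dyadic \<Longrightarrow> len (left_half I) = len I / 2"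
proof -
  assume "I \<in> dyadic"
  then obtain m k where "I = dyad m k" by (auto simp: dyadic_iff)
  then show ?thesis
    using powi_2_minus_1[of k] by (simp add: left_half_dyad len_dyad)
qed

lemma len_right_half: "I \<in> dyadic \<Longrightarrow> len (right_half I) = len I / 2"
proof -
  assume "I \<in> dyadic"
  then obtain m k where "I = dyad m k" by (auto simp: dyadic_iff)
  then show ?thesis
    using powi_2_minus_1[of k] by (simp add: right_half_dyad len_dyad)
qed

lemma halves_Un: "left_half I \<union> right_half I = I"
  by (auto simp: left_half_def right_half_def)

lemma halves_disjoint: "left_half I \<inter> right_half I = {}"
  by (auto simp: left_half_def right_half_def)

lemma left_half_subset: "left_half I \<subseteq> I" and right_half_subset: "right_half I \<subseteq> I"
  by (auto simp: left_half_def right_half_def)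

lemma dyadic_borel [measurable]: "I \<in> dyadic \<Longrightarrow> I \<in> sets borel"
  by (auto simp: dyadic_iff dyad_def)

lemma dyadic_emeasure: "I \<in> dyadic \<Longrightarrow> emeasure lborel I = ennreal (len I)"
proof -
  assume "I \<in> dyadic"
  then obtain m k where "I = dyad m k" by (auto simp: dyadic_iff)
  moreover have "emeasure lborel (dyad m k) < \<infinity>"
    using dyad_bounds_less[of m k] by (simp add: dyad_def)
  ultimately show ?thesis
    by (simp add: emeasure_eq_ennreal_measure)
qed

text \<open>The parity of \<open>m\<close> decides which half of the parent the interval is;
  \<open>m div 2\<close> is the index of the parent.\<close>

lemma dyad_parent: "dyad m k = left_half (dyad (m div 2) (k + 1)) \<or>
    dyad m k = right_half (dyad (m div 2) (k + 1))"
  by (cases "even m") (auto simp: left_half_dyad right_half_dyad)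

lemma dyad_ancestor: "\<exists>m'. dyad m k \<subseteq> dyad m' (k + int n)"
proof (induction n)
  case (Suc n)
  then obtain m' where "dyad m k \<subseteq> dyad m' (k + int n)" by blast
  also have "\<dots> \<subseteq> dyad (m' div 2) (k + int n + 1)"
    using dyad_parent[of m' "k + int n"] left_half_subset right_half_subset by metis
  finally show ?case by (auto simp: algebra_simps)
qed auto

text \<open>Climb from the smaller interval to its ancestor at scale \<open>k'\<close>; two
  intervals of the same scale coincide or are disjoint.\<close>

lemma dyad_nested_le:
  assumes "k \<le> k'"
  shows "dyad m k \<inter> dyad m' k' = {} \<or> dyad m k \<subseteq> dyad m' k'"
proof -
  obtain m'' where m'': "dyad m k \<subseteq> dyad m'' k'"
    using dyad_ancestor[of m k "nat (k' - k)"] assms by auto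
  show ?thesis
  proof (cases "m'' = m'")
    case False
    then have "dyad m'' k' \<inter> dyad m' k' = {}"
      by (auto simp: mem_dyad_iff)
    then show ?thesis using m'' by blast
  qed (use m'' in auto)
qed

lemma dyadic_nested:
  assumes "I \<in> dyadic" "J \<in> dyadic"
  shows "I \<inter> J = {} \<or> I \<subseteq> J \<or> J \<subseteq> I"
proof -
  obtain m k m' k' where "I = dyad m k" "J = dyad m' k'"
    using assms by (auto simp: dyadic_iff)
  then show ?thesis
    using dyad_nested_le[of k k' m m'] dyad_nested_le[of k' k m' m]
    by (metis linorder_linear inf_commute)
qed

lemma dyadic_parentE:
  assumes "I \<in> dyadic"
  obtains P where "P \<in> dyadic" "I = left_half P \<or> I = right_half P"
proof -
  obtain m k where "I = dyad m k" using assms by (auto simp: dyadic_iff)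
  then show thesis
    using dyad_parent[of m k] that[of "dyad (m div 2) (k + 1)"] by auto
qed

lemma half_psubset:
  assumes "I \<in> dyadic"
  shows "left_half I \<subset> I" "right_half I \<subset> I"
proof -
  have "len (left_half I) \<noteq> len I" "len (right_half I) \<noteq> len I"
    using len_pos[OF assms] len_left_half[OF assms] len_right_half[OF assms] by linarith+
  then show "left_half I \<subset> I" "right_half I \<subset> I"
    using left_half_subset[of I] right_half_subset[of I] by auto
qed

text \<open>A proper dyadic subinterval cannot straddle the midpoint: nestedness with each half
  leaves only containment in one of them, since an interval containing both halves would be all of
  \<open>I\<close>.\<close>

lemma psubset_dyadic_iff:
  assumes "K \<in> dyadic" "I \<in> dyadic"
  shows "K \<subset> I \<longleftrightarrow> K \<subseteq> left_half I \<or> K \<subseteq> right_half I"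
proof
  assume K: "K \<subset> I"
  note nest = dyadic_nested[OF assms(1) left_half_dyadic[OF assms(2)]]
    dyadic_nested[OF assms(1) right_half_dyadic[OF assms(2)]]
  show "K \<subseteq> left_half I \<or> K \<subseteq> right_half I"
    using nest K halves_Un[of I] halves_disjoint[of I] dyadic_nonempty[OF left_half_dyadic[OF assms(2)]]
      dyadic_nonempty[OF right_half_dyadic[OF assms(2)]]
    by blast
next
  assume "K \<subseteq> left_half I \<or> K \<subseteq> right_half I"
  then show "K \<subset> I" using half_psubset[OF assms(2)] by blast
qed

lemma descendants_halves:
  assumes "I \<in> dyadic"
  shows "{K \<in> dyadic. K \<subset> I} = {K \<in> dyadic. K \<subseteq> left_half I} \<union> {K \<in> dyadic. K \<subseteq> right_half I}"
    and "{K \<in> dyadic. K \<subseteq> left_half I} \<inter> {K \<in> dyadic. K \<subseteq> right_half I} = {}"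
proof -
  show "{K \<in> dyadic. K \<subset> I} = {K \<in> dyadic. K \<subseteq> left_half I} \<union> {K \<in> dyadic. K \<subseteq> right_half I}"
    using psubset_dyadic_iff[OF _ assms] by blast
  show "{K \<in> dyadic. K \<subseteq> left_half I} \<inter> {K \<in> dyadic. K \<subseteq> right_half I} = {}"
    using halves_disjoint[of I] dyadic_nonempty by blast
qed

lemma countable_dyadic: "countable dyadic"
proof -
  have "dyadic = range (\<lambda>(m, k). dyad m k)"
    using dyadic_iff by (auto simp: image_iff)
  then show ?thesis by (metis countableI_type countable_image)
qed

lemma infinite_dyadic: "infinite dyadic"
proof -
  have "inj (\<lambda>m. dyad m 0)"
  proof (rule injI)
    fix m m' :: int
    assume "dyad m 0 = dyad m' 0"
    then show "m = m'"
      using dyad_nonempty[of m 0] mem_dyad_iff by (metis equals0I)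
  qed
  then have "infinite (range (\<lambda>m. dyad m 0))"
    using finite_imageD infinite_UNIV_int by blast
  moreover have "range (\<lambda>m. dyad m 0) \<subseteq> dyadic" by auto
  ultimately show ?thesis
    using finite_subset by blast
qed

subsection \<open>Square integrable functions and the Haar system\<close>

lemma L2_measurable [measurable_dest]: "f \<in> L2 \<Longrightarrow> f \<in> borel_measurable lborel"
  by (simp add: L2_def)

lemma L2_integrable: "f \<in> L2 \<Longrightarrow> integrable lborel (\<lambda>x. (cmod (f x))\<^sup>2)"
  by (simp add: L2_def)

lemma norm_add_sq_le: "(norm (a + b :: 'a::real_normed_vector))\<^sup>2 \<le> 2 * (norm a)\<^sup>2 + 2 * (norm b)\<^sup>2"
proof -
  have "(norm (a + b))\<^sup>2 \<le> (norm a + norm b)\<^sup>2"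
    by (intro power_mono norm_triangle_ineq) auto
  also have "\<dots> \<le> 2 * (norm a)\<^sup>2 + 2 * (norm b)\<^sup>2"
    using sum_squares_bound[of "norm a" "norm b"] by (simp add: power2_sum)
  finally show ?thesis .
qed

lemma L2_add: assumes "f \<in> L2" "g \<in> L2" shows "(\<lambda>x. f x + g x) \<in> L2"
proof -
  have [measurable]: "f \<in> borel_measurable borel" "g \<in> borel_measurable borel"
    using assms by (auto simp: L2_def)
  have "integrable lborel (\<lambda>x. (cmod (f x + g x))\<^sup>2)"
  proof (rule Bochner_Integration.integrable_bound)
    show "integrable lborel (\<lambda>x. 2 * (cmod (f x))\<^sup>2 + 2 * (cmod (g x))\<^sup>2)"
      using assms by (intro Bochner_Integration.integrable_add integrable_mult_right L2_integrable)
    show "AE x in lborel. norm ((cmod (f x + g x))\<^sup>2) \<le> norm (2 * (cmod (f x))\<^sup>2 + 2 * (cmod (g x))\<^sup>2)"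
      using norm_add_sq_le[of "f _" "g _"] by (intro AE_I2) auto
  qed measurable
  then show ?thesis by (simp add: L2_def)
qed

lemma L2_cmult: assumes "f \<in> L2" shows "(\<lambda>x. c * f x) \<in> L2"
  using assms by (auto simp: L2_def norm_mult power_mult_distrib)

lemma L2_diff: assumes "f \<in> L2" "g \<in> L2" shows "(\<lambda>x. f x - g x) \<in> L2"
  using L2_add[OF assms(1) L2_cmult[OF assms(2), of "-1"]] by simp

lemma L2_zero: "(\<lambda>x. 0) \<in> L2"
  by (simp add: L2_def)

lemma L2_sum: assumes "\<And>i. i \<in> F \<Longrightarrow> f i \<in> L2" shows "(\<lambda>x. \<Sum>i\<in>F. f i x) \<in> L2"
  using assms
proof (induction F rule: infinite_finite_induct)
  case (insert i F)
  then show ?case using L2_add[of "f i" "\<lambda>x. \<Sum>i\<in>F. f i x"] by simp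
qed (auto simp: L2_zero)

lemma L2_inner_integrable:
  assumes "f \<in> L2" "g \<in> L2"
  shows "integrable lborel (\<lambda>x. f x * cnj (g x))"
proof (rule Bochner_Integration.integrable_bound)
  have [measurable]: "f \<in> borel_measurable borel" "g \<in> borel_measurable borel"
    using assms by (auto simp: L2_def)
  have [measurable]: "(\<lambda>x. cnj (g x)) \<in> borel_measurable borel"
    by (rule borel_measurable_continuous_on[where f = cnj]) (auto intro: continuous_intros)
  show "(\<lambda>x. f x * cnj (g x)) \<in> borel_measurable lborel" by measurable
  show "integrable lborel (\<lambda>x. (cmod (f x))\<^sup>2 + (cmod (g x))\<^sup>2)"
    using assms by (intro Bochner_Integration.integrable_add L2_integrable)
  have "cmod (f x) * cmod (g x) \<le> (cmod (f x))\<^sup>2 + (cmod (g x))\<^sup>2" for x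
    using sum_squares_bound[of "cmod (f x)" "cmod (g x)"]
      mult_nonneg_nonneg[OF norm_ge_zero[of "f x"] norm_ge_zero[of "g x"]] by linarith
  then show "AE x in lborel. norm (f x * cnj (g x)) \<le> norm ((cmod (f x))\<^sup>2 + (cmod (g x))\<^sup>2)"
    by (intro AE_I2) (auto simp: norm_mult)
qed

lemma L2_inner_cnj: "cnj (L2_inner f g) = L2_inner g f"
  unfolding L2_inner_def
  by (subst Bochner_Integration.integral_cnj[symmetric]) (simp add: mult.commute)

lemma L2_inner_add_left:
  assumes "f \<in> L2" "g \<in> L2" "h \<in> L2"
  shows "L2_inner (\<lambda>x. f x + g x) h = L2_inner f h + L2_inner g h"
  unfolding L2_inner_def distrib_right
  using assms by (intro Bochner_Integration.integral_add L2_inner_integrable)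

lemma L2_inner_diff_left:
  assumes "f \<in> L2" "g \<in> L2" "h \<in> L2"
  shows "L2_inner (\<lambda>x. f x - g x) h = L2_inner f h - L2_inner g h"
  unfolding L2_inner_def left_diff_distrib
  using assms by (intro Bochner_Integration.integral_diff L2_inner_integrable)

lemma L2_inner_cmult_left: "L2_inner (\<lambda>x. c * f x) h = c * L2_inner f h"
  by (simp add: L2_inner_def mult.assoc)

lemma L2_inner_sum_left:
  assumes "\<And>i. i \<in> F \<Longrightarrow> f i \<in> L2" "h \<in> L2"
  shows "L2_inner (\<lambda>x. \<Sum>i\<in>F. c i * f i x) h = (\<Sum>i\<in>F. c i * L2_inner (f i) h)"
proof -
  have "L2_inner (\<lambda>x. \<Sum>i\<in>F. c i * f i x) h = (LINT x|lborel. (\<Sum>i\<in>F. c i * f i x * cnj (h x)))"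
    by (simp add: L2_inner_def sum_distrib_right)
  also have "\<dots> = (\<Sum>i\<in>F. LINT x|lborel. c i * f i x * cnj (h x))"
    using assms by (intro Bochner_Integration.integral_sum L2_inner_integrable L2_cmult)
  also have "\<dots> = (\<Sum>i\<in>F. c i * L2_inner (f i) h)"
    by (simp add: L2_inner_def mult.assoc)
  finally show ?thesis .
qed

lemma L2_inner_sum_right:
  assumes "\<And>i. i \<in> F \<Longrightarrow> f i \<in> L2" "h \<in> L2"
  shows "L2_inner h (\<lambda>x. \<Sum>i\<in>F. c i * f i x) = (\<Sum>i\<in>F. cnj (c i) * L2_inner h (f i))"
proof -
  have "L2_inner h (\<lambda>x. \<Sum>i\<in>F. c i * f i x) = cnj (\<Sum>i\<in>F. c i * L2_inner (f i) h)"
    using L2_inner_sum_left[of F f h c, OF assms] by (metis L2_inner_cnj)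
  then show ?thesis by (simp add: L2_inner_cnj)
qed

lemma L2_norm_nonneg [simp]: "0 \<le> L2_norm f"
  by (simp add: L2_norm_def)

lemma L2_norm_sq: "(L2_norm f)\<^sup>2 = (LINT x|lborel. (cmod (f x))\<^sup>2)"
  by (simp add: L2_norm_def)

lemma L2_inner_self: "L2_inner f f = complex_of_real ((L2_norm f)\<^sup>2)"
  unfolding L2_norm_sq L2_inner_def
  unfolding integral_complex_of_real[symmetric] complex_norm_square ..

lemma L2_norm_cmult: "L2_norm (\<lambda>x. c * f x) = cmod c * L2_norm f"
  by (simp add: L2_norm_def norm_mult power_mult_distrib real_sqrt_mult)

text \<open>A crude substitute for Minkowski's inequality; the factor 2 is harmless because it is
  applied to errors that tend to zero.\<close>

lemma L2_norm_add_sq_le: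
  assumes "f \<in> L2" "g \<in> L2"
  shows "(L2_norm (\<lambda>x. f x + g x))\<^sup>2 \<le> 2 * (L2_norm f)\<^sup>2 + 2 * (L2_norm g)\<^sup>2"
proof -
  have "(LINT x|lborel. (cmod (f x + g x))\<^sup>2) \<le> (LINT x|lborel. 2 * (cmod (f x))\<^sup>2 + 2 * (cmod (g x))\<^sup>2)"
    using assms L2_add[OF assms]
    by (intro integral_mono norm_add_sq_le Bochner_Integration.integrable_add integrable_mult_right L2_integrable)
  also have "\<dots> = 2 * (LINT x|lborel. (cmod (f x))\<^sup>2) + 2 * (LINT x|lborel. (cmod (g x))\<^sup>2)"
    using assms by (simp add: L2_integrable)
  finally show ?thesis by (simp add: L2_norm_sq)
qed

lemma L2_norm_diff_commute: "L2_norm (\<lambda>x. f x - g x) = L2_norm (\<lambda>x. g x - f x)"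
  by (simp add: L2_norm_def norm_minus_commute)

lemma L2_norm_diff_sq:
  assumes "f \<in> L2" "g \<in> L2"
  shows "(L2_norm (\<lambda>x. f x - g x))\<^sup>2 = (L2_norm f)\<^sup>2 - 2 * Re (L2_inner f g) + (L2_norm g)\<^sup>2"
proof -
  have d: "(\<lambda>x. f x - g x) \<in> L2" using L2_diff[OF assms] .
  have "L2_inner (\<lambda>x. f x - g x) (\<lambda>x. f x - g x) =
      L2_inner f (\<lambda>x. f x - g x) - L2_inner g (\<lambda>x. f x - g x)"
    using L2_inner_diff_left[OF assms d] .
  also have "L2_inner f (\<lambda>x. f x - g x) = cnj (L2_inner f f - L2_inner g f)"
    using L2_inner_diff_left[OF assms assms(1)] by (metis L2_inner_cnj)
  also have "L2_inner g (\<lambda>x. f x - g x) = cnj (L2_inner f g - L2_inner g g)"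
    using L2_inner_diff_left[OF assms assms(2)] by (metis L2_inner_cnj)
  finally have "Re (L2_inner (\<lambda>x. f x - g x) (\<lambda>x. f x - g x)) =
      Re (L2_inner f f) - Re (L2_inner g f) - (Re (L2_inner f g) - Re (L2_inner g g))"
    by simp
  moreover have "Re (L2_inner g f) = Re (L2_inner f g)"
    by (metis L2_inner_cnj complex_cnj(1) complex.collapse complex.sel(1))
  ultimately show ?thesis by (simp add: L2_inner_self)
qed

section \<open>Haar functions: values, cancellation, orthonormality and Bessel's inequality\<close>

lemma haar_0: "haar 0 I x =
    complex_of_real ((indicator (right_half I) x - indicator (left_half I) x) / sqrt (len I))"
  by (simp add: haar_def)

lemma haar_1: "haar 1 I x = complex_of_real (indicator I x / len I)"
  by (simp add: haar_def)

lemma cnj_haar [simp]: "cnj (haar \<alpha> I x) = haar \<alpha> I x"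
  by (simp add: haar_def)

lemma bit_cases: "\<alpha> = 0 \<or> \<alpha> = (1::bit)"
  by (cases \<alpha>) auto

lemma haar_eq_0: "x \<notin> I \<Longrightarrow> haar \<alpha> I x = 0"
  using left_half_subset[of I] right_half_subset[of I] by (auto simp: haar_def indicator_def)

lemma cmod_haar_0_sq: assumes "I \<in> dyadic" shows "(cmod (haar 0 I x))\<^sup>2 = indicator I x / len I"
proof -
  have "indicator I x = (indicator (right_half I) x - indicator (left_half I) x :: real)\<^sup>2"
    using halves_Un[of I] halves_disjoint[of I] by (auto simp: indicator_def)
  then show ?thesis
    using len_pos[OF assms]
    by (simp only: haar_0 norm_of_real power2_abs power_divide real_sqrt_pow2 less_imp_le)
qed

lemma cmod_haar_1_sq: "(cmod (haar 1 I x))\<^sup>2 = indicator I x / (len I)\<^sup>2"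
  by (auto simp: haar_1 power_divide indicator_def norm_divide)

lemma integrable_indicator_dyadic: "I \<in> dyadic \<Longrightarrow> integrable lborel (indicator I :: real \<Rightarrow> real)"
  by (simp add: dyadic_emeasure dyadic_borel integrable_real_indicator)

lemma haar_measurable: "I \<in> dyadic \<Longrightarrow> haar \<alpha> I \<in> borel_measurable borel"
  using dyadic_borel[of I] dyadic_borel[of "left_half I"] dyadic_borel[of "right_half I"]
  unfolding haar_def by (cases "\<alpha> = 0") auto

lemma haar_L2 [simp]: assumes "I \<in> dyadic" shows "haar \<alpha> I \<in> L2"
proof -
  have "integrable lborel (\<lambda>x. (cmod (haar \<alpha> I x))\<^sup>2)"
    using bit_cases[of \<alpha>] integrable_indicator_dyadic[OF assms]
    by (elim disjE) (simp_all add: cmod_haar_0_sq[OF assms] cmod_haar_1_sq)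
  then show ?thesis
    using haar_measurable[OF assms] by (simp add: L2_def)
qed

lemma haar_span_L2: "f \<in> haar_span \<Longrightarrow> f \<in> L2"
  unfolding haar_span_def by (auto intro!: L2_sum L2_cmult haar_L2)

lemma haar_in_haar_span: "I \<in> dyadic \<Longrightarrow> haar 0 I \<in> haar_span"
  unfolding haar_span_def by (intro CollectI exI[of _ "{I}"] exI[of _ "\<lambda>_. 1"]) auto

lemma L2_norm_haar_0: assumes "I \<in> dyadic" shows "L2_norm (haar 0 I) = 1"
  using len_pos[OF assms] dyadic_borel[OF assms]
  by (simp add: L2_norm_def cmod_haar_0_sq[OF assms])

text \<open>The constant value of \<open>h\<^sub>J\<close> on a dyadic \<open>K \<subset> J\<close>.\<close>

definition haar_val :: "real set \<Rightarrow> real set \<Rightarrow> real" where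
  "haar_val J K = (if K \<subseteq> right_half J then 1 else if K \<subseteq> left_half J then -1 else 0) / sqrt (len J)"

lemma haar_val_eq_0: "K \<in> dyadic \<Longrightarrow> J \<in> dyadic \<Longrightarrow> \<not> K \<subset> J \<Longrightarrow> haar_val J K = 0"
  using psubset_dyadic_iff[of K J] by (auto simp: haar_val_def)

lemma haar_val_left: "K \<in> dyadic \<Longrightarrow> K \<subseteq> left_half J \<Longrightarrow> haar_val J K = - 1 / sqrt (len J)"
  using dyadic_nonempty[of K] halves_disjoint[of J] by (auto simp: haar_val_def)

lemma haar_val_right: "K \<subseteq> right_half J \<Longrightarrow> haar_val J K = 1 / sqrt (len J)"
  by (auto simp: haar_val_def)

lemma haar_val_sq:
  assumes "K \<in> dyadic" "J \<in> dyadic"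
  shows "haar_val J K * haar_val J K = (if K \<subset> J then 1 / len J else 0)"
  using psubset_dyadic_iff[OF assms] len_pos[OF assms(2)] by (auto simp: haar_val_def)

lemma abs_haar_val_le: "J \<in> dyadic \<Longrightarrow> \<bar>haar_val J K\<bar> \<le> 1 / sqrt (len J)"
  using len_pos[of J] by (auto simp: haar_val_def)

text \<open>\<open>haar 0 J\<close> is constant on the half of \<open>J\<close> that contains
  \<open>L\<close>. This lets its value leave a sum over the subintervals \<open>K\<close> of
  \<open>L\<close>.\<close>

lemma haar_val_mono:
  assumes "K \<in> dyadic" "L \<in> dyadic" "J \<in> dyadic" "K \<subseteq> L" "L \<subset> J"
  shows "haar_val J K = haar_val J L"
proof -
  consider "L \<subseteq> left_half J" | "L \<subseteq> right_half J"
    using psubset_dyadic_iff[OF assms(2,3)] assms(5) by blast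
  then show ?thesis
  proof cases
    case 1
    then show ?thesis
      using assms haar_val_left[of K J] haar_val_left[of L J] by auto
  next
    case 2
    then show ?thesis
      using assms haar_val_right[of K J] haar_val_right[of L J] by auto
  qed
qed

lemma haar_0_on:
  assumes "K \<in> dyadic" "J \<in> dyadic" "K \<subset> J" "x \<in> K"
  shows "haar 0 J x = complex_of_real (haar_val J K)"
  using psubset_dyadic_iff[OF assms(1,2)] assms halves_disjoint[of J] haar_val_left[of K J] haar_val_right[of K J]
  by (auto simp: haar_0 indicator_def)

lemma integral_haar_0:
  assumes "J \<in> dyadic" shows "(LINT x|lborel. haar 0 J x) = 0"
proof -
  have "(LINT x|lborel. (indicator (right_half J) x - indicator (left_half J) x) / sqrt (len J)) = (0::real)"
    using integrable_indicator_dyadic[OF left_half_dyadic[OF assms]]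
      integrable_indicator_dyadic[OF right_half_dyadic[OF assms]] len_left_half[OF assms] len_right_half[OF assms]
      dyadic_borel[OF left_half_dyadic[OF assms]] dyadic_borel[OF right_half_dyadic[OF assms]]
    by simp
  then show ?thesis unfolding haar_0 by (subst integral_complex_of_real) simp
qed

text \<open>The pairing averages \<open>haar 0 J\<close> over \<open>K\<close>. On a proper
  subinterval the function is constant, over an interval containing \<open>J\<close> its
  cancellation gives zero, and disjoint supports give zero.\<close>

lemma haar_1_haar_0:
  assumes "K \<in> dyadic" "J \<in> dyadic"
  shows "L2_inner (haar 1 K) (haar 0 J) = complex_of_real (haar_val J K)"
proof -
  consider "K \<subset> J" | "J \<subseteq> K" | "K \<inter> J = {}" "\<not> K \<subset> J"
    using dyadic_nested[OF assms] by blast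
  then show ?thesis
  proof cases
    case 1
    have "haar 1 K x * cnj (haar 0 J x) = complex_of_real (haar_val J K * indicator K x / len K)" for x
      using haar_0_on[OF assms 1, of x] by (cases "x \<in> K") (simp_all add: haar_1)
    then have "L2_inner (haar 1 K) (haar 0 J) =
        complex_of_real (LINT x|lborel. haar_val J K * indicator K x / len K)"
      by (simp only: L2_inner_def integral_complex_of_real)
    then show ?thesis
      using len_pos[OF assms(1)] dyadic_borel[OF assms(1)] by simp
  next
    case 2
    have "haar 1 K x * cnj (haar 0 J x) = complex_of_real (1 / len K) * haar 0 J x" for x
      using 2 haar_eq_0[of x J 0] by (cases "x \<in> J") (auto simp: haar_1)
    then have "L2_inner (haar 1 K) (haar 0 J) = complex_of_real (1 / len K) * (LINT x|lborel. haar 0 J x)"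
      by (simp only: L2_inner_def integral_mult_right_zero)
    moreover have "haar_val J K = 0" using 2 haar_val_eq_0[OF assms] by auto
    ultimately show ?thesis by (simp add: integral_haar_0 assms)
  next
    case 3
    have "haar 1 K x * cnj (haar 0 J x) = 0" for x
      using 3 haar_eq_0[of x J 0] haar_eq_0[of x K 1] by (cases "x \<in> J") auto
    then have "L2_inner (haar 1 K) (haar 0 J) = 0" by (simp only: L2_inner_def integral_zero)
    then show ?thesis using 3 haar_val_eq_0[OF assms] by simp
  qed
qed

lemma haar_0_haar_1:
  assumes "K \<in> dyadic" "J \<in> dyadic"
  shows "L2_inner (haar 0 J) (haar 1 K) = complex_of_real (haar_val J K)"
  using haar_1_haar_0[OF assms] by (metis L2_inner_cnj complex_cnj_complex_of_real)

text \<open>For properly nested intervals the larger function is constant on the support of the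
  smaller one, which has integral zero.\<close>

lemma haar_orthonormal:
  assumes "I \<in> dyadic" "J \<in> dyadic"
  shows "L2_inner (haar 0 I) (haar 0 J) = (if I = J then 1 else 0)"
proof -
  have *: "L2_inner (haar 0 I) (haar 0 J) = 0" if "I \<in> dyadic" "J \<in> dyadic" "J \<subset> I" for I J
  proof -
    have "haar 0 I x * cnj (haar 0 J x) = complex_of_real (haar_val I J) * haar 0 J x" for x
      using haar_0_on[OF that(2,1,3), of x] haar_eq_0[of x J 0] by (cases "x \<in> J") auto
    then show ?thesis
      by (simp only: L2_inner_def integral_mult_right_zero) (simp add: integral_haar_0 that)
  qed
  consider "I = J" | "J \<subset> I" | "I \<subset> J" | "I \<inter> J = {}" "I \<noteq> J"
    using dyadic_nested[OF assms] by blast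
  then show ?thesis
  proof cases
    case 1
    then show ?thesis by (simp add: L2_inner_self L2_norm_haar_0 assms)
  next
    case 2
    then show ?thesis using *[OF assms] by auto
  next
    case 3
    then show ?thesis using *[OF assms(2,1)] L2_inner_cnj by (metis complex_cnj_zero less_irrefl)
  next
    case 4
    have "haar 0 I x * cnj (haar 0 J x) = 0" for x
      using 4 haar_eq_0[of x J 0] haar_eq_0[of x I 0] by (cases "x \<in> J") auto
    then have "L2_inner (haar 0 I) (haar 0 J) = 0" by (simp only: L2_inner_def integral_zero)
    then show ?thesis using 4 by simp
  qed
qed

lemma haar_sum_inner:
  assumes "finite F" "F \<subseteq> dyadic" "J \<in> dyadic"
  shows "L2_inner (\<lambda>x. \<Sum>I\<in>F. c I * haar 0 I x) (haar 0 J) = (if J \<in> F then c J else 0)"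
proof -
  have "L2_inner (\<lambda>x. \<Sum>I\<in>F. c I * haar 0 I x) (haar 0 J) = (\<Sum>I\<in>F. c I * L2_inner (haar 0 I) (haar 0 J))"
    using assms by (intro L2_inner_sum_left) auto
  also have "\<dots> = (\<Sum>I\<in>F. if I = J then c I else 0)"
    using assms by (intro sum.cong) (auto simp: haar_orthonormal subset_iff)
  finally show ?thesis using assms by simp
qed

lemma haar_sum_norm_sq:
  assumes "finite F" "F \<subseteq> dyadic"
  shows "(L2_norm (\<lambda>x. \<Sum>I\<in>F. c I * haar 0 I x))\<^sup>2 = (\<Sum>I\<in>F. (cmod (c I))\<^sup>2)"
proof -
  let ?s = "\<lambda>x. \<Sum>I\<in>F. c I * haar 0 I x"
  have s: "?s \<in> L2" using assms by (intro L2_sum L2_cmult) auto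
  have "complex_of_real ((L2_norm ?s)\<^sup>2) = (\<Sum>I\<in>F. cnj (c I) * L2_inner ?s (haar 0 I))"
    unfolding L2_inner_self[symmetric] using assms s by (intro L2_inner_sum_right) auto
  also have "\<dots> = (\<Sum>I\<in>F. cnj (c I) * c I)"
    using assms by (intro sum.cong) (simp_all add: haar_sum_inner subset_iff)
  also have "\<dots> = complex_of_real (\<Sum>I\<in>F. (cmod (c I))\<^sup>2)"
    unfolding of_real_sum complex_norm_square by (simp add: mult.commute)
  finally show ?thesis by (simp only: of_real_eq_iff)
qed

text \<open>Expand the squared distance of \<open>f\<close> from its partial Haar sum, which is
  nonnegative.\<close>

lemma haar_bessel:
  assumes "finite F" "F \<subseteq> dyadic" "f \<in> L2"
  shows "(\<Sum>I\<in>F. (cmod (L2_inner f (haar 0 I)))\<^sup>2) \<le> (L2_norm f)\<^sup>2"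
proof -
  let ?c = "\<lambda>I. L2_inner f (haar 0 I)"
  let ?s = "\<lambda>x. \<Sum>I\<in>F. ?c I * haar 0 I x"
  have s: "?s \<in> L2" using assms by (intro L2_sum L2_cmult) auto
  have "L2_inner f ?s = (\<Sum>I\<in>F. cnj (?c I) * ?c I)"
    using assms by (intro L2_inner_sum_right) auto
  also have "\<dots> = complex_of_real (\<Sum>I\<in>F. (cmod (?c I))\<^sup>2)"
    unfolding of_real_sum complex_norm_square by (simp add: mult.commute)
  finally have "Re (L2_inner f ?s) = (\<Sum>I\<in>F. (cmod (?c I))\<^sup>2)" by simp
  then have "(L2_norm (\<lambda>x. f x - ?s x))\<^sup>2 = (L2_norm f)\<^sup>2 - (\<Sum>I\<in>F. (cmod (?c I))\<^sup>2)"
    using L2_norm_diff_sq[OF assms(3) s] haar_sum_norm_sq[OF assms(1,2), of ?c] by simp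
  then show ?thesis using zero_le_power2[of "L2_norm (\<lambda>x. f x - ?s x)"] by linarith
qed

subsection \<open>Riesz--Fischer\<close>

lemma L2_nn_integral:
  "f \<in> L2 \<Longrightarrow> (\<integral>\<^sup>+x. ennreal ((cmod (f x))\<^sup>2) \<partial>lborel) = ennreal ((L2_norm f)\<^sup>2)"
  unfolding L2_norm_sq by (intro nn_integral_eq_integral L2_integrable) auto

text \<open>Fatou's lemma for the squared moduli: the bound passes to pointwise limits, and with it
  membership in \<open>L2\<close>.\<close>

lemma L2_fatou:
  assumes f: "\<And>k. f k \<in> L2" and B: "\<And>k::nat. (L2_norm (f k))\<^sup>2 \<le> B"
    and g: "g \<in> borel_measurable lborel" and lim: "AE x in lborel. (\<lambda>k. f k x) \<longlonglongrightarrow> g x"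
  shows "g \<in> L2" "(L2_norm g)\<^sup>2 \<le> B"
proof -
  have B0: "0 \<le> B" using B[of 0] by (meson order_trans zero_le_power2)
  have "AE x in lborel. ennreal ((cmod (g x))\<^sup>2) = liminf (\<lambda>k. ennreal ((cmod (f k x))\<^sup>2))"
    using lim
  proof eventually_elim
    case (elim x)
    then have "(\<lambda>k. ennreal ((cmod (f k x))\<^sup>2)) \<longlonglongrightarrow> ennreal ((cmod (g x))\<^sup>2)"
      by (intro tendsto_intros)
    then show ?case by (intro lim_imp_Liminf[symmetric]) auto
  qed
  then have "(\<integral>\<^sup>+x. ennreal ((cmod (g x))\<^sup>2) \<partial>lborel) =
      (\<integral>\<^sup>+x. liminf (\<lambda>k. ennreal ((cmod (f k x))\<^sup>2)) \<partial>lborel)"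
    by (rule nn_integral_cong_AE)
  also have "\<dots> \<le> liminf (\<lambda>k. \<integral>\<^sup>+x. ennreal ((cmod (f k x))\<^sup>2) \<partial>lborel)"
  proof (rule nn_integral_liminf)
    fix k
    have [measurable]: "f k \<in> borel_measurable lborel" using f by (rule L2_measurable)
    show "(\<lambda>x. ennreal ((cmod (f k x))\<^sup>2)) \<in> borel_measurable lborel" by measurable
  qed
  also have "\<dots> \<le> liminf (\<lambda>k::nat. ennreal B)"
    using B by (intro Liminf_mono always_eventually) (auto simp: L2_nn_integral f intro: ennreal_leI)
  finally have le: "(\<integral>\<^sup>+x. ennreal ((cmod (g x))\<^sup>2) \<partial>lborel) \<le> ennreal B"
    by (simp add: Liminf_const)
  have "integrable lborel (\<lambda>x. (cmod (g x))\<^sup>2)"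
  proof (rule integrableI_nonneg)
    show "(\<lambda>x. (cmod (g x))\<^sup>2) \<in> borel_measurable lborel" using g by measurable
  qed (use le order_le_less_trans in \<open>auto simp: less_top[symmetric] top_unique\<close>)
  then show "g \<in> L2" using g by (simp add: L2_def)
  then show "(L2_norm g)\<^sup>2 \<le> B"
    using le B0 by (simp add: L2_nn_integral)
qed

text \<open>A subsequence whose successive differences \<open>d\<^sub>k\<close> satisfy \<open>\<parallel>d\<^sub>k\<parallel>\<^sup>2 \<le> 8\<^sup>-\<^sup>k\<close> converges almost
  everywhere, because the integral of \<open>\<Sum>k. 4\<^sup>k |d\<^sub>k|\<^sup>2\<close> is finite.\<close>

lemma L2_complete:
  assumes s: "\<And>n. s n \<in> L2"
    and cauchy: "\<And>e. 0 < e \<Longrightarrow> \<exists>N. \<forall>m\<ge>N. \<forall>n\<ge>N. (L2_norm (\<lambda>x. s m x - s n x))\<^sup>2 < e"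
  obtains g where "g \<in> L2" "(\<lambda>n. (L2_norm (\<lambda>x. g x - s n x))\<^sup>2) \<longlonglongrightarrow> 0"
proof -
  have "\<forall>k. \<exists>N. \<forall>m\<ge>N. \<forall>n\<ge>N. (L2_norm (\<lambda>x. s m x - s n x))\<^sup>2 < (1 / 8) ^ k"
    using cauchy by simp
  then obtain N where N: "\<And>k m n. m \<ge> N k \<Longrightarrow> n \<ge> N k \<Longrightarrow> (L2_norm (\<lambda>x. s m x - s n x))\<^sup>2 < (1 / 8) ^ k"
    by metis
  \<comment> \<open>Summing the thresholds places \<open>r l\<close> beyond every \<open>N k\<close>
    with \<open>k \<le> l\<close>.\<close>
  define r where "r k = (\<Sum>i\<le>k. N i)" for k
  have rN: "N k \<le> r l" if "k \<le> l" for k l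
    unfolding r_def using that by (intro member_le_sum) auto
  define d where "d k x = s (r (Suc k)) x - s (r k) x" for k x
  have d: "d k \<in> L2" for k unfolding d_def by (intro L2_diff s)
  have [measurable]: "d k \<in> borel_measurable lborel" "s k \<in> borel_measurable lborel" for k
    using d s by (auto simp: L2_def)
  have "(\<integral>\<^sup>+x. (\<Sum>k. ennreal (4 ^ k * (cmod (d k x))\<^sup>2)) \<partial>lborel) =
      (\<Sum>k. \<integral>\<^sup>+x. ennreal (4 ^ k * (cmod (d k x))\<^sup>2) \<partial>lborel)"
    by (rule nn_integral_suminf) measurable
  also have "\<dots> = (\<Sum>k. ennreal (4 ^ k * (L2_norm (d k))\<^sup>2))"
    by (simp add: ennreal_mult nn_integral_cmult L2_nn_integral d)
  also have "\<dots> \<le> (\<Sum>k. ennreal ((1 / 2) ^ k))"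
  proof (rule suminf_le)
    fix k
    have "4 ^ k * (L2_norm (d k))\<^sup>2 \<le> 4 ^ k * (1 / 8) ^ k"
      unfolding d_def using N[of k "r (Suc k)" "r k"] rN by (intro mult_left_mono) auto
    also have "\<dots> = (1 / 2) ^ k" by (simp flip: power_mult_distrib)
    finally show "ennreal (4 ^ k * (L2_norm (d k))\<^sup>2) \<le> ennreal ((1 / 2) ^ k)" by (rule ennreal_leI)
  qed auto
  also have "\<dots> = ennreal (\<Sum>k. (1 / 2) ^ k)"
    by (rule suminf_ennreal2) (auto intro: summable_geometric)
  finally have "(\<integral>\<^sup>+x. (\<Sum>k. ennreal (4 ^ k * (cmod (d k x))\<^sup>2)) \<partial>lborel) \<noteq> \<infinity>"
    by (auto simp: top_unique)
  then have "AE x in lborel. (\<Sum>k. ennreal (4 ^ k * (cmod (d k x))\<^sup>2)) \<noteq> \<infinity>"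
    by (intro nn_integral_PInf_AE) measurable
  then have conv: "AE x in lborel. convergent (\<lambda>k. s (r k) x)"
  proof eventually_elim
    case (elim x)
    have term_le: "u k \<le> suminf u" for u :: "nat \<Rightarrow> ennreal" and k
      using sum_le_suminf[of u "{k}"] by simp
    have "\<exists>B\<ge>0. S = ennreal B" if "S \<noteq> \<infinity>" for S
      using that by (cases S) auto
    from this[OF elim] obtain B
      where B: "(\<Sum>k. ennreal (4 ^ k * (cmod (d k x))\<^sup>2)) = ennreal B" "0 \<le> B"
      by blast
    \<comment> \<open>Each term is at most the total \<open>B\<close>, and the weight
      \<open>4 ^ k\<close> turns this into geometric decay of the differences.\<close>
    have "cmod (d k x) \<le> sqrt B * (1 / 2) ^ k" for k
    proof -
      have "ennreal (4 ^ k * (cmod (d k x))\<^sup>2) \<le> ennreal B"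
        unfolding B(1)[symmetric] by (rule term_le)
      then have "4 ^ k * (cmod (d k x))\<^sup>2 \<le> B"
        using B(2) by simp
      moreover have "(4::real) ^ k = (2 ^ k)\<^sup>2"
        using power_even_eq[of "2::real" k] power_mult[of "2::real" 2 k] by simp
      ultimately have "(2 ^ k * cmod (d k x))\<^sup>2 \<le> B"
        by (simp only: power_mult_distrib)
      then have "2 ^ k * cmod (d k x) \<le> sqrt B"
        by (rule real_le_rsqrt)
      then show ?thesis by (simp add: field_simps)
    qed
    moreover have "summable (\<lambda>k. sqrt B * (1 / 2) ^ k)"
      by (intro summable_mult summable_geometric) simp
    ultimately have "summable (\<lambda>k. d k x)"
      using summable_comparison_test' by metis
    then have "convergent (\<lambda>n. \<Sum>k<n. d k x)"
      by (simp add: summable_iff_convergent)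
    then have "convergent (\<lambda>n. (\<Sum>k<n. d k x) + s (r 0) x)"
      by (intro convergent_add convergent_const)
    then show ?case
      unfolding d_def by (subst (asm) sum_lessThan_telescope) simp
  qed
  define g where "g x = lim (\<lambda>k. s (r k) x)" for x
  have g[measurable]: "g \<in> borel_measurable lborel"
    unfolding g_def by measurable
  have g_lim: "AE x in lborel. (\<lambda>k. s (r k) x) \<longlonglongrightarrow> g x"
    using conv by eventually_elim (simp add: g_def convergent_LIMSEQ_iff)
  have *: "(\<lambda>x. g x - s n x) \<in> L2 \<and> (L2_norm (\<lambda>x. g x - s n x))\<^sup>2 \<le> (1 / 8) ^ j"
    if "n \<ge> N j" for n j
  proof -
    \<comment> \<open>With \<open>n\<close> fixed, the other index runs along the subsequence; the
      shift by \<open>j\<close> keeps it beyond \<open>N j\<close>, so Fatou bounds the distance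
      from \<open>s n\<close> to the limit.\<close>
    let ?f = "\<lambda>k x. s (r (k + j)) x - s n x"
    have f: "?f k \<in> L2" for k by (intro L2_diff s)
    have b: "(L2_norm (?f k))\<^sup>2 \<le> (1 / 8) ^ j" for k
      using N[of j "r (k + j)" n] rN[of j "k + j"] that by simp
    have m: "(\<lambda>x. g x - s n x) \<in> borel_measurable lborel" by measurable
    have "AE x in lborel. (\<lambda>k. ?f k x) \<longlonglongrightarrow> g x - s n x"
      using g_lim
    proof eventually_elim
      case (elim x)
      then have "(\<lambda>k. s (r (k + j)) x) \<longlonglongrightarrow> g x"
        by (rule LIMSEQ_ignore_initial_segment)
      then show ?case by (intro tendsto_intros)
    qed
    then show ?thesis using L2_fatou[of ?f, OF f b m] by simp
  qed
  have "g \<in> L2"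
    using L2_add[OF conjunct1[OF *[of 0 "N 0"]] s[of "N 0"]] by simp
  moreover have "(\<lambda>n. (L2_norm (\<lambda>x. g x - s n x))\<^sup>2) \<longlonglongrightarrow> 0"
  proof (rule LIMSEQ_I)
    fix e :: real assume "0 < e"
    then obtain j where "(1 / 8 :: real) ^ j < e"
      using real_arch_pow_inv[of e "1 / 8"] by auto
    then show "\<exists>n0. \<forall>n\<ge>n0. norm ((L2_norm (\<lambda>x. g x - s n x))\<^sup>2 - 0) < e"
      using * by (intro exI[of _ "N j"]) force
  qed
  ultimately show ?thesis by (rule that)
qed

section \<open>Haar series with square summable coefficients\<close>

definition haar_enum :: "nat \<Rightarrow> real set" where
  "haar_enum = from_nat_into dyadic"

lemma haar_enum_bij: "bij_betw haar_enum UNIV dyadic"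
  unfolding haar_enum_def by (intro bij_betw_from_nat_into countable_dyadic infinite_dyadic)

lemma haar_enum_inj: "inj_on haar_enum A"
  using haar_enum_bij by (meson bij_betw_def inj_on_subset subset_UNIV)

lemma haar_enum_dyadic [simp]: "haar_enum k \<in> dyadic"
  using haar_enum_bij by (auto simp: bij_betw_def)

definition haar_partial :: "(real set \<Rightarrow> complex) \<Rightarrow> nat set \<Rightarrow> real \<Rightarrow> complex" where
  "haar_partial c A x = (\<Sum>I\<in>haar_enum ` A. c I * haar 0 I x)"

lemma haar_partial_L2: "haar_partial c A \<in> L2"
  unfolding haar_partial_def by (intro L2_sum L2_cmult) auto

lemma haar_partial_norm_sq:
  "finite A \<Longrightarrow> (L2_norm (haar_partial c A))\<^sup>2 = (\<Sum>k\<in>A. (cmod (c (haar_enum k)))\<^sup>2)"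
  unfolding haar_partial_def
  by (subst haar_sum_norm_sq) (auto simp: sum.reindex haar_enum_inj)

text \<open>A relation, because convergence in norm determines \<open>g\<close> only almost
  everywhere. The fixed enumeration makes the partial sums a sequence, as \<open>L2_complete\<close>
  requires.\<close>

definition haar_expansion :: "(real set \<Rightarrow> complex) \<Rightarrow> (real \<Rightarrow> complex) \<Rightarrow> bool" where
  "haar_expansion c g \<longleftrightarrow>
     g \<in> L2 \<and> (\<lambda>n. (L2_norm (\<lambda>x. g x - haar_partial c {..<n} x))\<^sup>2) \<longlonglongrightarrow> 0"

text \<open>By orthonormality the squared distance of two partial sums is a block of the series of
  squared coefficients, so summability gives the Cauchy property.\<close>

lemma haar_expansion_exists:
  assumes "\<And>F. finite F \<Longrightarrow> F \<subseteq> dyadic \<Longrightarrow> (\<Sum>I\<in>F. (cmod (c I))\<^sup>2) \<le> B"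
  obtains g where "haar_expansion c g"
proof -
  have "(\<Sum>k<n. (cmod (c (haar_enum k)))\<^sup>2) \<le> B" for n
    using assms[of "haar_enum ` {..<n}"] by (simp add: sum.reindex haar_enum_inj image_subset_iff)
  then have sm: "summable (\<lambda>k. (cmod (c (haar_enum k)))\<^sup>2)"
    by (intro summableI_nonneg_bounded) auto
  have diff: "(L2_norm (\<lambda>x. haar_partial c {..<n} x - haar_partial c {..<m} x))\<^sup>2 =
      (\<Sum>k=m..<n. (cmod (c (haar_enum k)))\<^sup>2)" if "m \<le> n" for m n
  proof -
    have "haar_partial c {..<n} x - haar_partial c {..<m} x = haar_partial c {m..<n} x" for x
      using sum_diff_nat_ivl[of 0 m n "\<lambda>k. c (haar_enum k) * haar 0 (haar_enum k) x"] that
      by (simp add: haar_partial_def sum.reindex haar_enum_inj atLeast0LessThan)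
    then show ?thesis by (simp add: haar_partial_norm_sq)
  qed
  obtain g where "g \<in> L2" "(\<lambda>n. (L2_norm (\<lambda>x. g x - haar_partial c {..<n} x))\<^sup>2) \<longlonglongrightarrow> 0"
  proof (rule L2_complete[of "\<lambda>n. haar_partial c {..<n}", OF haar_partial_L2])
    fix e :: real assume "0 < e"
    then obtain N where N: "\<And>m n. m \<ge> N \<Longrightarrow> norm (\<Sum>k=m..<n. (cmod (c (haar_enum k)))\<^sup>2) < e"
      using sm unfolding summable_Cauchy by metis
    have *: "(L2_norm (\<lambda>x. haar_partial c {..<m} x - haar_partial c {..<n} x))\<^sup>2 < e"
      if "m \<ge> N" "n \<ge> N" "n \<le> m" for m n
      using N[OF that(2), of m] diff[OF that(3)] by (simp add: sum_nonneg)
    show "\<exists>N. \<forall>m\<ge>N. \<forall>n\<ge>N. (L2_norm (\<lambda>x. haar_partial c {..<m} x - haar_partial c {..<n} x))\<^sup>2 < e"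
      using * L2_norm_diff_commute by (metis nle_le)
  qed
  then show ?thesis using that by (simp add: haar_expansion_def)
qed

text \<open>Bessel's inequality for the single function \<open>haar 0 J\<close> bounds the
  coefficient error by the norm of the remainder, once the partial sum includes
  \<open>J\<close>.\<close>

lemma haar_expansion_coeff:
  assumes "haar_expansion c g" "J \<in> dyadic"
  shows "L2_inner g (haar 0 J) = c J"
proof -
  have g: "g \<in> L2" and lim: "(\<lambda>n. (L2_norm (\<lambda>x. g x - haar_partial c {..<n} x))\<^sup>2) \<longlonglongrightarrow> 0"
    using assms by (auto simp: haar_expansion_def)
  obtain k where k: "J = haar_enum k"
    using assms(2) haar_enum_bij by (auto simp: bij_betw_def)
  have "(cmod (L2_inner g (haar 0 J) - c J))\<^sup>2 \<le> (L2_norm (\<lambda>x. g x - haar_partial c {..<n} x))\<^sup>2"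
    if "n \<ge> Suc k" for n
  proof -
    have "L2_inner (haar_partial c {..<n}) (haar 0 J) = c J"
      unfolding haar_partial_def using that k by (subst haar_sum_inner) auto
    then show ?thesis
      using haar_bessel[of "{J}" "\<lambda>x. g x - haar_partial c {..<n} x"] assms(2)
      by (simp add: L2_diff g haar_partial_L2 L2_inner_diff_left)
  qed
  then have "(cmod (L2_inner g (haar 0 J) - c J))\<^sup>2 \<le> 0"
    by (intro LIMSEQ_le_const[OF lim] exI[of _ "Suc k"]) auto
  then show ?thesis by simp
qed

text \<open>The squared remainder equals the squared norm of \<open>g\<close> minus the sum of the
  squared coefficients used so far, and that sum is at most \<open>B\<close>; the remainder tends to
  zero.\<close>

lemma haar_expansion_norm_le:
  assumes g: "haar_expansion c g"
    and B: "\<And>F. finite F \<Longrightarrow> F \<subseteq> dyadic \<Longrightarrow> (\<Sum>I\<in>F. (cmod (c I))\<^sup>2) \<le> B"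
  shows "(L2_norm g)\<^sup>2 \<le> B"
proof -
  have gL: "g \<in> L2" and lim: "(\<lambda>n. (L2_norm (\<lambda>x. g x - haar_partial c {..<n} x))\<^sup>2) \<longlonglongrightarrow> 0"
    using g by (auto simp: haar_expansion_def)
  have "(L2_norm g)\<^sup>2 - B \<le> (L2_norm (\<lambda>x. g x - haar_partial c {..<n} x))\<^sup>2" for n
  proof -
    let ?A = "haar_enum ` {..<n}"
    have "L2_inner g (haar_partial c {..<n}) = (\<Sum>I\<in>?A. cnj (c I) * L2_inner g (haar 0 I))"
      unfolding haar_partial_def using gL by (intro L2_inner_sum_right) auto
    also have "\<dots> = (\<Sum>I\<in>?A. cnj (c I) * c I)"
      using g by (intro sum.cong) (auto simp: haar_expansion_coeff)
    also have "\<dots> = complex_of_real (\<Sum>I\<in>?A. (cmod (c I))\<^sup>2)"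
      unfolding of_real_sum complex_norm_square by (simp add: mult.commute)
    finally have "Re (L2_inner g (haar_partial c {..<n})) = (\<Sum>I\<in>?A. (cmod (c I))\<^sup>2)" by simp
    moreover have "(L2_norm (haar_partial c {..<n}))\<^sup>2 = (\<Sum>I\<in>?A. (cmod (c I))\<^sup>2)"
      unfolding haar_partial_def by (intro haar_sum_norm_sq) auto
    moreover have "(\<Sum>I\<in>?A. (cmod (c I))\<^sup>2) \<le> B" by (intro B) auto
    ultimately show ?thesis
      using L2_norm_diff_sq[OF gL haar_partial_L2, of c "{..<n}"] by linarith
  qed
  then have "(L2_norm g)\<^sup>2 - B \<le> 0"
    by (intro LIMSEQ_le_const[OF lim]) auto
  then show ?thesis by simp
qed

lemma L2_norm_eq_0_AE:
  assumes "f \<in> L2" "(L2_norm f)\<^sup>2 = 0"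
  shows "AE x in lborel. f x = 0"
  using assms integral_nonneg_eq_0_iff_AE[OF L2_integrable[OF assms(1)]] by (simp add: L2_norm_sq)

text \<open>For every \<open>n\<close> the partial sums cancel exactly, so the defect is a
  combination of three remainders and its norm vanishes. Linearity of the operator almost everywhere
  comes from here.\<close>

lemma haar_expansion_linear:
  assumes "haar_expansion c f" "haar_expansion c' f'" "haar_expansion c'' g"
    and eq: "\<And>I. I \<in> dyadic \<Longrightarrow> c'' I = z * c I + c' I"
  shows "AE x in lborel. g x = z * f x + f' x"
proof -
  have L: "f \<in> L2" "f' \<in> L2" "g \<in> L2" using assms by (auto simp: haar_expansion_def)
  let ?e = "\<lambda>c f n. (\<lambda>x. f x - haar_partial c {..<n} x)"
  have eL: "?e c f n \<in> L2" if "f \<in> L2" for c f n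
    using that by (intro L2_diff haar_partial_L2)
  have zL: "(\<lambda>x. z * f x + f' x) \<in> L2" using L by (intro L2_add L2_cmult)
  have "(L2_norm (\<lambda>x. g x - (z * f x + f' x)))\<^sup>2 \<le>
      2 * (L2_norm (?e c'' g n))\<^sup>2 + 2 * (2 * ((cmod z)\<^sup>2 * (L2_norm (?e c f n))\<^sup>2) + 2 * (L2_norm (?e c' f' n))\<^sup>2)" for n
  proof -
    have "haar_partial c'' {..<n} x = z * haar_partial c {..<n} x + haar_partial c' {..<n} x" for x
      unfolding haar_partial_def sum_distrib_left sum.distrib[symmetric]
      by (intro sum.cong) (auto simp: eq algebra_simps)
    then have "g x - (z * f x + f' x) = ?e c'' g n x + (-1) * (z * ?e c f n x + ?e c' f' n x)" for x
      by (simp add: algebra_simps)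
    then have "(L2_norm (\<lambda>x. g x - (z * f x + f' x)))\<^sup>2 \<le>
        2 * (L2_norm (?e c'' g n))\<^sup>2 + 2 * (L2_norm (\<lambda>x. (-1) * (z * ?e c f n x + ?e c' f' n x)))\<^sup>2"
      by (simp only: L2_norm_add_sq_le L2_add L2_cmult eL L)
    also have "(L2_norm (\<lambda>x. (-1) * (z * ?e c f n x + ?e c' f' n x)))\<^sup>2 =
        (L2_norm (\<lambda>x. z * ?e c f n x + ?e c' f' n x))\<^sup>2"
      unfolding L2_norm_cmult by simp
    also have "\<dots> \<le> 2 * (L2_norm (\<lambda>x. z * ?e c f n x))\<^sup>2 + 2 * (L2_norm (?e c' f' n))\<^sup>2"
      by (intro L2_norm_add_sq_le L2_cmult eL L)
    finally show ?thesis by (simp add: L2_norm_cmult power_mult_distrib)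
  qed
  moreover have "(\<lambda>n. 2 * (L2_norm (?e c'' g n))\<^sup>2 +
      2 * (2 * ((cmod z)\<^sup>2 * (L2_norm (?e c f n))\<^sup>2) + 2 * (L2_norm (?e c' f' n))\<^sup>2)) \<longlonglongrightarrow>
      2 * 0 + 2 * (2 * ((cmod z)\<^sup>2 * 0) + 2 * 0)"
    using assms unfolding haar_expansion_def by (intro tendsto_add tendsto_mult tendsto_const) auto
  ultimately have "(L2_norm (\<lambda>x. g x - (z * f x + f' x)))\<^sup>2 \<le> 2 * 0 + 2 * (2 * ((cmod z)\<^sup>2 * 0) + 2 * 0)"
    by (intro LIMSEQ_le_const) auto
  then have "(L2_norm (\<lambda>x. g x - (z * f x + f' x)))\<^sup>2 = 0" by simp
  then have "AE x in lborel. g x - (z * f x + f' x) = 0"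
    by (intro L2_norm_eq_0_AE L2_diff L zL)
  then show ?thesis by eventually_elim simp
qed

subsection \<open>The Carleson embedding theorem\<close>

text \<open>The top \<open>n\<close> generations of the tree rooted at \<open>I\<close>. The Bellman
  induction runs along this recursion, with the empty tree as base case.\<close>

fun dtree :: "nat \<Rightarrow> real set \<Rightarrow> real set set" where
  "dtree 0 I = {}"
| "dtree (Suc n) I = insert I (dtree n (left_half I) \<union> dtree n (right_half I))"

lemma finite_dtree [simp]: "finite (dtree n I)"
  by (induction n arbitrary: I) auto

lemma dtree_subset: "I \<in> dyadic \<Longrightarrow> dtree n I \<subseteq> {K \<in> dyadic. K \<subseteq> I}"
proof (induction n arbitrary: I)
  case (Suc n)
  then show ?case
    using Suc.IH[of "left_half I"] Suc.IH[of "right_half I"] left_half_subset[of I] right_half_subset[of I]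
    by auto blast+
qed auto

lemma sum_dtree_Suc:
  assumes I: "I \<in> dyadic"
  shows "sum w (dtree (Suc n) I) = w I + sum w (dtree n (left_half I)) + sum w (dtree n (right_half I))"
proof -
  note sub = dtree_subset[OF left_half_dyadic[OF I], of n] dtree_subset[OF right_half_dyadic[OF I], of n]
  have "I \<notin> dtree n (left_half I) \<union> dtree n (right_half I)"
    using sub half_psubset[OF I] by auto
  moreover have "dtree n (left_half I) \<inter> dtree n (right_half I) = {}"
    using Int_mono[OF sub] unfolding descendants_halves(2)[OF I] by simp
  ultimately show ?thesis
    by (simp add: sum.union_disjoint add.assoc)
qed

lemma len_mono: assumes "K \<in> dyadic" "I \<in> dyadic" "K \<subseteq> I" shows "len K \<le> len I"
  using assms by (intro measure_mono_fmeasurable)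
    (auto simp: dyadic_borel fmeasurable_def dyadic_emeasure)

text \<open>Each generation halves the length, so a length ratio of at most \<open>2 ^ n\<close> is
  covered within \<open>n\<close> steps below the root; the root accounts for the
  \<open>Suc\<close>.\<close>

lemma dtree_exhaust:
  assumes "K \<in> dyadic" "I \<in> dyadic" "K \<subseteq> I" "len I \<le> 2 ^ n * len K"
  shows "K \<in> dtree (Suc n) I"
  using assms
proof (induction n arbitrary: I)
  case 0
  have "\<not> K \<subset> I"
  proof
    assume "K \<subset> I"
    then have "len K \<le> len I / 2"
      using psubset_dyadic_iff[of K I] 0 len_mono[of K "left_half I"] len_mono[of K "right_half I"]
        len_left_half[of I] len_right_half[of I] by auto
    then show False using 0 len_pos[OF 0(1)] by simp
  qed
  then show ?case using 0 by auto
next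
  case (Suc n)
  show ?case
  proof (cases "K = I")
    case False
    then have "K \<subseteq> left_half I \<or> K \<subseteq> right_half I"
      using psubset_dyadic_iff[of K I] Suc.prems by auto
    then show ?thesis
    proof
      assume "K \<subseteq> left_half I"
      then have "K \<in> dtree (Suc n) (left_half I)"
        using Suc.prems by (intro Suc.IH) (auto simp: len_left_half)
      then show ?thesis by (subst dtree.simps) blast
    next
      assume "K \<subseteq> right_half I"
      then have "K \<in> dtree (Suc n) (right_half I)"
        using Suc.prems by (intro Suc.IH) (auto simp: len_right_half)
      then show ?thesis by (subst dtree.simps) blast
    qed
  qed simp
qed

lemma finite_subset_dtree:
  assumes "finite F" "F \<subseteq> {K \<in> dyadic. K \<subseteq> I}" "I \<in> dyadic"
  obtains n where "F \<subseteq> dtree n I"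
proof -
  have "\<exists>n. len I < 2 ^ n * len K" if "K \<in> F" for K
  proof -
    have "0 < len K" using that assms by auto
    moreover obtain n where "len I / len K < 2 ^ n"
      using real_arch_pow[of 2 "len I / len K"] by auto
    ultimately show ?thesis by (auto simp: field_simps)
  qed
  then obtain n where n: "\<And>K. K \<in> F \<Longrightarrow> len I < 2 ^ n K * len K"
    by metis
  \<comment> \<open>The sum of the individual depths serves as a common depth.\<close>
  have "K \<in> dtree (Suc (sum n F)) I" if "K \<in> F" for K
  proof (rule dtree_exhaust)
    have "n K \<le> sum n F" using that assms(1) by (intro member_le_sum) auto
    then have "(2::real) ^ n K * len K \<le> 2 ^ sum n F * len K"
      by (intro mult_right_mono power_increasing) auto
    then show "len I \<le> 2 ^ sum n F * len K" using n[OF that] by linarith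
  qed (use that assms in auto)
  then show ?thesis using that by blast
qed

text \<open>Joint convexity of the square of \<open>x\<close> divided by \<open>s\<close>: the
  difference of the two sides is a square over a positive product. It merges the two halves in the
  Bellman induction.\<close>

lemma sum_sq_div_ge:
  fixes s t :: real
  assumes "0 < s" "0 < t"
  shows "(x + y)\<^sup>2 / (s + t) \<le> x\<^sup>2 / s + y\<^sup>2 / t"
proof -
  have "x\<^sup>2 / s + y\<^sup>2 / t - (x + y)\<^sup>2 / (s + t) = (x * t - y * s)\<^sup>2 / (s * t * (s + t))"
    using assms by (simp add: field_simps power2_eq_square)
  also have "\<dots> \<ge> 0" using assms by simp
  finally show ?thesis by simp
qed

text \<open>Induction on the generations with the Bellman function \<open>4 (F - x\<^sup>2 / (1 + A))\<close> of the averages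
  \<open>F\<close> of \<open>f\<^sup>2\<close>, \<open>x\<close> of \<open>f\<close>, and \<open>A\<close> of the Carleson sequence, written without normalisations.\<close>

lemma carleson_bellman:
  fixes \<beta> Y G :: "real set \<Rightarrow> real"
  assumes "0 < Q" and \<beta>: "\<And>I. 0 \<le> \<beta> I"
    and Y: "\<And>I. I \<in> dyadic \<Longrightarrow> Y I = Y (left_half I) + Y (right_half I)"
    and G: "\<And>I. I \<in> dyadic \<Longrightarrow> G I = G (left_half I) + G (right_half I)"
    and YG: "\<And>I. I \<in> dyadic \<Longrightarrow> (Y I)\<^sup>2 \<le> len I * G I"
    and carleson: "\<And>n I. I \<in> dyadic \<Longrightarrow> sum \<beta> (dtree n I) \<le> Q * len I"
    and "I \<in> dyadic"
  shows "(\<Sum>K\<in>dtree n I. \<beta> K * (Y K / len K)\<^sup>2) \<le>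
    4 * Q * (G I - Q * (Y I)\<^sup>2 / (Q * len I + sum \<beta> (dtree n I)))"
  using \<open>I \<in> dyadic\<close>
proof (induction n arbitrary: I)
  case 0
  have "Q * (Y I)\<^sup>2 / (Q * len I) \<le> G I"
    using YG[OF 0] \<open>0 < Q\<close> len_pos[OF 0] by (simp add: field_simps)
  then show ?case using \<open>0 < Q\<close> by simp
next
  case (Suc n)
  let ?l = "left_half I" and ?r = "right_half I"
  define s where "s J = Q * len J + sum \<beta> (dtree n J)" for J
  have s: "0 < s J" if "J \<in> dyadic" for J
    unfolding s_def using that \<open>0 < Q\<close> \<beta> by (intro add_pos_nonneg sum_nonneg) auto
  have sl: "0 < s ?l" "0 < s ?r" using Suc.prems by (auto intro: s)
  define t where "t = s ?l + s ?r"
  have t: "t = Q * len I + (sum \<beta> (dtree n ?l) + sum \<beta> (dtree n ?r))"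
    using Suc.prems by (simp add: t_def s_def len_left_half len_right_half)
  have t0: "0 < t" using sl by (simp add: t_def)
  have sum_eq: "Q * len I + sum \<beta> (dtree (Suc n) I) = t + \<beta> I"
    using sum_dtree_Suc[OF Suc.prems, of \<beta> n] t by simp
  \<comment> \<open>One \<open>Q * len I\<close> is built into the denominator, and the Carleson
    condition at \<open>I\<close> bounds the tree sum by another.\<close>
  have tb: "t + \<beta> I \<le> 2 * Q * len I"
    using carleson[OF Suc.prems, of "Suc n"] sum_eq by linarith
  have "t * (t + \<beta> I) \<le> (2 * Q * len I) * (2 * Q * len I)"
    using tb \<beta>[of I] t0 by (intro mult_mono) auto
  then have prod_le: "t * (t + \<beta> I) \<le> 4 * Q\<^sup>2 * (len I)\<^sup>2"
    by (simp add: power2_eq_square algebra_simps)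
  \<comment> \<open>Enlarging the denominator from \<open>t\<close> to \<open>t + \<beta> I\<close>
    lowers the quotient by enough to pay for the term of the root; the factor 4 is the square of the
    2 in \<open>tb\<close>.\<close>
  have "\<beta> I * (Y I / len I)\<^sup>2 = 4 * Q\<^sup>2 * (\<beta> I * (Y I)\<^sup>2 / (4 * Q\<^sup>2 * (len I)\<^sup>2))"
    using \<open>0 < Q\<close> len_pos[OF Suc.prems] by (simp add: power_divide)
  also have "\<dots> \<le> 4 * Q\<^sup>2 * (\<beta> I * (Y I)\<^sup>2 / (t * (t + \<beta> I)))"
    using prod_le t0 \<beta>[of I] \<open>0 < Q\<close> len_pos[OF Suc.prems]
    by (intro mult_left_mono divide_left_mono mult_pos_pos add_pos_nonneg) auto
  also have "\<beta> I * (Y I)\<^sup>2 / (t * (t + \<beta> I)) = (Y I)\<^sup>2 / t - (Y I)\<^sup>2 / (t + \<beta> I)"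
    using t0 \<beta>[of I] by (simp add: field_simps)
  finally have drop: "\<beta> I * (Y I / len I)\<^sup>2 \<le> 4 * Q\<^sup>2 * ((Y I)\<^sup>2 / t - (Y I)\<^sup>2 / (t + \<beta> I))" .
  have conv: "4 * Q\<^sup>2 * ((Y I)\<^sup>2 / t) \<le> 4 * Q\<^sup>2 * ((Y ?l)\<^sup>2 / s ?l + (Y ?r)\<^sup>2 / s ?r)"
    unfolding Y[OF Suc.prems] t_def using sum_sq_div_ge[OF sl] by (intro mult_left_mono) auto
  have "(\<Sum>K\<in>dtree (Suc n) I. \<beta> K * (Y K / len K)\<^sup>2) \<le> \<beta> I * (Y I / len I)\<^sup>2 +
      4 * Q * (G ?l - Q * (Y ?l)\<^sup>2 / s ?l) + 4 * Q * (G ?r - Q * (Y ?r)\<^sup>2 / s ?r)"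
    unfolding sum_dtree_Suc[OF Suc.prems] s_def
    using Suc.IH[OF left_half_dyadic[OF Suc.prems]] Suc.IH[OF right_half_dyadic[OF Suc.prems]]
    by linarith
  also have "\<dots> = \<beta> I * (Y I / len I)\<^sup>2 + 4 * Q * G I - 4 * Q\<^sup>2 * ((Y ?l)\<^sup>2 / s ?l + (Y ?r)\<^sup>2 / s ?r)"
    unfolding G[OF Suc.prems] by (simp add: algebra_simps power2_eq_square)
  also have "\<dots> \<le> 4 * Q * G I - 4 * Q\<^sup>2 * ((Y I)\<^sup>2 / (t + \<beta> I))"
    using drop conv by (simp add: algebra_simps)
  also have "\<dots> = 4 * Q * (G I - Q * (Y I)\<^sup>2 / (Q * len I + sum \<beta> (dtree (Suc n) I)))"
    unfolding sum_eq by (simp add: algebra_simps power2_eq_square)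
  finally show ?case .
qed

section \<open>Averages over dyadic intervals and the passage from local to global estimates\<close>

lemma L2_integrable_on_dyadic:
  assumes "f \<in> L2" "I \<in> dyadic"
  shows "integrable lborel (\<lambda>x. indicator I x * (cmod (f x))\<^sup>2)"
    and "integrable lborel (\<lambda>x. indicator I x * cmod (f x))"
proof -
  have [measurable]: "f \<in> borel_measurable borel" "I \<in> sets borel"
    using assms by (auto simp: L2_def dyadic_borel)
  show 1: "integrable lborel (\<lambda>x. indicator I x * (cmod (f x))\<^sup>2)"
    using integrable_mult_indicator[OF _ L2_integrable[OF assms(1)], of I] by simp
  show "integrable lborel (\<lambda>x. indicator I x * cmod (f x))"
  proof (rule Bochner_Integration.integrable_bound)
    show "integrable lborel (\<lambda>x. indicator I x + indicator I x * (cmod (f x))\<^sup>2 :: real)"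
      using 1 integrable_indicator_dyadic[OF assms(2)] by (intro Bochner_Integration.integrable_add)
    have "y \<le> 1 + y\<^sup>2" for y :: real
      using sum_squares_bound[of y 1] zero_le_power2[of y] by (simp, linarith)
    then show "AE x in lborel. norm (indicator I x * cmod (f x)) \<le>
        norm (indicator I x + indicator I x * (cmod (f x))\<^sup>2 :: real)"
      by (intro AE_I2) (auto simp: indicator_def)
  qed measurable
qed

lemma indicator_halves:
  "indicator I x = (indicator (left_half I) x + indicator (right_half I) x :: real)"
  using halves_Un[of I] halves_disjoint[of I] by (auto simp: indicator_def)

text \<open>The variance of \<open>cmod (f x)\<close> over \<open>I\<close> is nonnegative;
  \<open>t\<close> is the mean.\<close>

lemma integral_cauchy_schwarz_dyadic:
  assumes "f \<in> L2" "I \<in> dyadic"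
  shows "(LINT x|lborel. indicator I x * cmod (f x))\<^sup>2 \<le> len I * (LINT x|lborel. indicator I x * (cmod (f x))\<^sup>2)"
proof -
  let ?Y = "LINT x|lborel. indicator I x * cmod (f x)" and ?G = "LINT x|lborel. indicator I x * (cmod (f x))\<^sup>2"
  define t where "t = ?Y / len I"
  note int = L2_integrable_on_dyadic[OF assms] integrable_indicator_dyadic[OF assms(2)]
  have "0 \<le> (LINT x|lborel. indicator I x * (cmod (f x) - t)\<^sup>2)"
    by (intro integral_nonneg_AE AE_I2) auto
  also have "(\<lambda>x. indicator I x * (cmod (f x) - t)\<^sup>2) = (\<lambda>x. indicator I x * (cmod (f x))\<^sup>2 -
      2 * t * (indicator I x * cmod (f x)) + t\<^sup>2 * indicator I x)"
    by (auto simp: power2_diff algebra_simps)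
  also have "(LINT x|lborel. \<dots> x) = ?G - 2 * t * ?Y + t\<^sup>2 * len I"
    using int dyadic_borel[OF assms(2)] by simp
  also have "\<dots> = ?G - ?Y\<^sup>2 / len I"
    using len_pos[OF assms(2)] by (simp add: t_def field_simps power2_eq_square)
  finally show ?thesis
    using len_pos[OF assms(2)] by (simp add: field_simps)
qed

text \<open>At every point the indicators of disjoint intervals add up to at most one.\<close>

lemma sum_integral_dyadic_disjoint_le:
  assumes f: "f \<in> L2" and T: "finite T" "T \<subseteq> dyadic" "disjoint T"
  shows "(\<Sum>I\<in>T. LINT x|lborel. indicator I x * (cmod (f x))\<^sup>2) \<le> (L2_norm f)\<^sup>2"
proof -
  have "(\<Sum>I\<in>T. LINT x|lborel. indicator I x * (cmod (f x))\<^sup>2) =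
      (LINT x|lborel. (\<Sum>I\<in>T. indicator I x * (cmod (f x))\<^sup>2))"
    using L2_integrable_on_dyadic(1)[OF f] T by (intro Bochner_Integration.integral_sum[symmetric]) auto
  also have "\<dots> \<le> (LINT x|lborel. (cmod (f x))\<^sup>2)"
  proof (rule integral_mono)
    show "integrable lborel (\<lambda>x. \<Sum>I\<in>T. indicator I x * (cmod (f x))\<^sup>2)"
      using L2_integrable_on_dyadic(1)[OF f] T by (intro Bochner_Integration.integrable_sum) auto
    show "integrable lborel (\<lambda>x. (cmod (f x))\<^sup>2)" using f by (rule L2_integrable)
    fix x
    have "(\<Sum>I\<in>T. indicator I x :: real) \<le> 1"
    proof (cases "\<exists>I\<in>T. x \<in> I")
      case True
      then obtain I where I: "I \<in> T" "x \<in> I" by blast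
      have "(\<Sum>J\<in>T. indicator J x :: real) = (\<Sum>J\<in>T. if J = I then 1 else 0)"
        using I T(3) by (intro sum.cong) (auto simp: indicator_def disjoint_def)
      then show ?thesis using T I by simp
    qed auto
    then show "(\<Sum>I\<in>T. indicator I x * (cmod (f x))\<^sup>2) \<le> (cmod (f x))\<^sup>2"
      unfolding sum_distrib_right[symmetric] using mult_right_mono[of _ 1 "(cmod (f x))\<^sup>2"] by fastforce
  qed
  finally show ?thesis by (simp add: L2_norm_sq)
qed

lemma cmod_average_le:
  assumes "f \<in> L2" "I \<in> dyadic"
  shows "cmod (L2_inner f (haar 1 I)) \<le> (LINT x|lborel. indicator I x * cmod (f x)) / len I"
proof -
  have "cmod (L2_inner f (haar 1 I)) \<le> (LINT x|lborel. cmod (f x * cnj (haar 1 I x)))"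
    unfolding L2_inner_def by (rule integral_norm_bound)
  also have "(\<lambda>x. cmod (f x * cnj (haar 1 I x))) = (\<lambda>x. indicator I x * cmod (f x) / len I)"
    by (auto simp: haar_1 norm_mult norm_divide indicator_def)
  finally show ?thesis by simp
qed

text \<open>The Bellman estimate is local to one root. The maximal intervals of the finite family
  \<open>F\<close> serve as roots: they are disjoint, so their local masses add up to at most the
  full squared norm.\<close>

theorem carleson_embedding:
  fixes \<beta> :: "real set \<Rightarrow> real"
  assumes f: "f \<in> L2" and \<beta>: "\<And>I. 0 \<le> \<beta> I" and "0 \<le> Q"
    and carleson: "\<And>I F. I \<in> dyadic \<Longrightarrow> finite F \<Longrightarrow> F \<subseteq> {K \<in> dyadic. K \<subseteq> I} \<Longrightarrow> sum \<beta> F \<le> Q * len I"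
    and F: "finite F" "F \<subseteq> dyadic"
  shows "(\<Sum>K\<in>F. \<beta> K * (cmod (L2_inner f (haar 1 K)))\<^sup>2) \<le> 4 * Q * (L2_norm f)\<^sup>2"
proof (cases "Q = 0")
  case True
  \<comment> \<open>For \<open>Q = 0\<close> the condition on a single interval forces the weight to
    vanish; the Bellman lemma requires \<open>0 < Q\<close>.\<close>
  have "\<beta> K = 0" if "K \<in> F" for K
    using carleson[of K "{K}"] \<beta>[of K] that F True by auto
  then show ?thesis using True by simp
next
  case False
  then have "0 < Q" using \<open>0 \<le> Q\<close> by simp
  define Y where "Y I = (LINT x|lborel. indicator I x * cmod (f x))" for I
  define G where "G I = (LINT x|lborel. indicator I x * (cmod (f x))\<^sup>2)" for I
  note int = L2_integrable_on_dyadic[OF f]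
  have Y: "Y I = Y (left_half I) + Y (right_half I)" if "I \<in> dyadic" for I
    unfolding Y_def indicator_halves[of I] distrib_right using that int
    by (intro Bochner_Integration.integral_add) auto
  have G: "G I = G (left_half I) + G (right_half I)" if "I \<in> dyadic" for I
    unfolding G_def indicator_halves[of I] distrib_right using that int
    by (intro Bochner_Integration.integral_add) auto
  let ?w = "\<lambda>K. \<beta> K * (Y K / len K)\<^sup>2"
  have w: "0 \<le> ?w K" for K using \<beta> by simp
  have local: "sum ?w {K \<in> F. K \<subseteq> I} \<le> 4 * Q * G I" if I: "I \<in> dyadic" for I
  proof -
    obtain n where n: "{K \<in> F. K \<subseteq> I} \<subseteq> dtree n I"
    proof (rule finite_subset_dtree[of "{K \<in> F. K \<subseteq> I}" I])
      show "{K \<in> F. K \<subseteq> I} \<subseteq> {K \<in> dyadic. K \<subseteq> I}" using F by auto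
    qed (use F I in auto)
    have "sum ?w {K \<in> F. K \<subseteq> I} \<le> sum ?w (dtree n I)"
      using n w by (intro sum_mono2) auto
    also have "\<dots> \<le> 4 * Q * (G I - Q * (Y I)\<^sup>2 / (Q * len I + sum \<beta> (dtree n I)))"
    proof (rule carleson_bellman[OF \<open>0 < Q\<close> \<beta> Y G _ _ I])
      show "(Y I)\<^sup>2 \<le> len I * G I" if "I \<in> dyadic" for I
        unfolding Y_def G_def using integral_cauchy_schwarz_dyadic[OF f that] .
      show "sum \<beta> (dtree n I) \<le> Q * len I" if "I \<in> dyadic" for n I
        using that dtree_subset[OF that] by (intro carleson) auto
    qed
    \<comment> \<open>The subtracted quotient is nonnegative and is dropped.\<close>
    also have "\<dots> \<le> 4 * Q * G I"
      using \<open>0 < Q\<close> len_pos[OF I] \<beta> by (intro mult_left_mono) (auto intro!: divide_nonneg_nonneg add_nonneg_nonneg sum_nonneg)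
    finally show ?thesis .
  qed
  define T where "T = {I \<in> F. \<forall>J\<in>F. I \<subseteq> J \<longrightarrow> I = J}"
  have T: "finite T" "T \<subseteq> dyadic" using F by (auto simp: T_def)
  have disj: "disjoint T"
  proof (rule disjointI)
    fix I J assume "I \<in> T" "J \<in> T" "I \<noteq> J"
    then have "I \<in> dyadic" "J \<in> dyadic" "\<not> I \<subseteq> J" "\<not> J \<subseteq> I"
      using F(2) by (auto simp: T_def)
    then show "I \<inter> J = {}" using dyadic_nested by blast
  qed
  have cover: "F = (\<Union>I\<in>T. {K \<in> F. K \<subseteq> I})"
  proof (intro equalityI subsetI)
    fix K assume K: "K \<in> F"
    obtain I where "I \<in> F" "K \<subseteq> I" "\<forall>J\<in>F. I \<subseteq> J \<longrightarrow> I = J"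
      using finite_has_maximal2[OF F(1) K] by blast
    then show "K \<in> (\<Union>I\<in>T. {K \<in> F. K \<subseteq> I})" using K by (auto simp: T_def)
  qed auto
  have "(\<Sum>K\<in>F. \<beta> K * (cmod (L2_inner f (haar 1 K)))\<^sup>2) \<le> sum ?w F"
    using F cmod_average_le[OF f] unfolding Y_def
    by (intro sum_mono mult_left_mono power_mono \<beta>) auto
  also have "sum ?w F = (\<Sum>I\<in>T. sum ?w {K \<in> F. K \<subseteq> I})"
  proof (subst cover, rule sum.UNION_disjoint)
    have "{K \<in> F. K \<subseteq> I} \<inter> {K \<in> F. K \<subseteq> J} = {}" if "I \<in> T" "J \<in> T" "I \<noteq> J" for I J
    proof -
      have "I \<inter> J = {}" using that disj by (auto simp: disjoint_def)
      moreover have "K \<noteq> {}" if "K \<in> F" for K using that F(2) dyadic_nonempty by auto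
      ultimately show ?thesis by (auto simp: disjoint_iff) (metis all_not_in_conv subsetD)
    qed
    then show "\<forall>i\<in>T. \<forall>j\<in>T. i \<noteq> j \<longrightarrow> {K \<in> F. K \<subseteq> i} \<inter> {K \<in> F. K \<subseteq> j} = {}" by blast
  qed (use F T in auto)
  also have "\<dots> \<le> (\<Sum>I\<in>T. 4 * Q * G I)"
    using T local by (intro sum_mono) auto
  also have "\<dots> = 4 * Q * (\<Sum>I\<in>T. G I)" by (simp add: sum_distrib_left)
  also have "\<dots> \<le> 4 * Q * (L2_norm f)\<^sup>2"
    unfolding G_def using \<open>0 \<le> Q\<close> by (intro mult_left_mono sum_integral_dyadic_disjoint_le f T disj) auto
  finally show ?thesis .
qed

subsection \<open>The matrix of the paraproduct\<close>

text \<open>A total counterpart of \<open>sweep\<close>, with the default 0 of \<open>infsum\<close>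
  where the series diverges; \<open>sweep_eq\<close> identifies the two when \<open>a\<close> is
  summable below \<open>I\<close>.\<close>

definition sweep_val :: "(real set \<Rightarrow> complex) \<Rightarrow> real set \<Rightarrow> complex" where
  "sweep_val a I = (\<Sum>\<^sub>\<infinity>K\<in>{K \<in> dyadic. K \<subset> I}. a K * complex_of_real (haar_val I K))"

definition diag_val :: "(real set \<Rightarrow> complex) \<Rightarrow> real set \<Rightarrow> complex" where
  "diag_val a I = (\<Sum>\<^sub>\<infinity>K\<in>{K \<in> dyadic. K \<subset> I}. a K) / complex_of_real (len I)"

lemma has_sum_sum:
  fixes f :: "'i \<Rightarrow> 'k \<Rightarrow> 'c::topological_comm_monoid_add"
  assumes "finite F" "\<And>i. i \<in> F \<Longrightarrow> (f i has_sum s i) A"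
  shows "((\<lambda>x. \<Sum>i\<in>F. f i x) has_sum (\<Sum>i\<in>F. s i)) A"
  using assms by (induction F rule: finite_induct) (auto intro!: has_sum_add has_sum_0)

text \<open>For complex series unconditional summability is absolute summability, so multiplication
  by the bounded factor \<open>haar_val J K\<close> preserves it.\<close>

lemma summable_mult_haar_val:
  assumes "a summable_on A" "J \<in> dyadic"
  shows "(\<lambda>K. a K * complex_of_real (haar_val J K)) summable_on A"
proof -
  have "(\<lambda>K. cmod (a K * complex_of_real (haar_val J K))) summable_on A"
  proof (rule Infinite_Sum.abs_summable_on_comparison_test)
    show "(\<lambda>K. cmod (complex_of_real (1 / sqrt (len J)) * a K)) summable_on A"
      using summable_on_cmult_right[OF assms(1), of "complex_of_real (1 / sqrt (len J))"]
      by (simp only: summable_on_iff_abs_summable_on_complex)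
    show "cmod (a K * complex_of_real (haar_val J K)) \<le> cmod (complex_of_real (1 / sqrt (len J)) * a K)" for K
      using mult_right_mono[OF abs_haar_val_le[OF assms(2), of K], of "cmod (a K)"] len_pos[OF assms(2)]
      by (simp add: norm_mult norm_divide mult.commute)
  qed
  then show ?thesis by (rule Infinite_Sum.abs_summable_summable)
qed

text \<open>At most one of the three terms is nonzero.\<close>

lemma haar_matrix_has_sum:
  assumes summ: "\<And>I. I \<in> dyadic \<Longrightarrow> a summable_on {K \<in> dyadic. K \<subset> I}"
    and IJ: "I \<in> dyadic" "J \<in> dyadic"
  shows "((\<lambda>K. a K * complex_of_real (haar_val I K) * complex_of_real (haar_val J K)) has_sum
    (sweep_val a J * complex_of_real (haar_val I J) + (if I = J then diag_val a J else 0) +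
     sweep_val a I * complex_of_real (haar_val J I))) dyadic"
proof -
  \<comment> \<open>The factor \<open>haar_val J K\<close> restricts the sum to \<open>K\<close>
    properly inside \<open>J\<close>, where \<open>haar_val I K\<close> has the constant value
    \<open>haar_val I J\<close>; what remains is the sweep entry at \<open>J\<close>.\<close>
  have sub: "((\<lambda>K. a K * complex_of_real (haar_val I K) * complex_of_real (haar_val J K)) has_sum
      (sweep_val a J * complex_of_real (haar_val I J))) dyadic"
    if IJ: "I \<in> dyadic" "J \<in> dyadic" "J \<subset> I" for I J
  proof -
    have "((\<lambda>K. a K * complex_of_real (haar_val J K)) has_sum sweep_val a J) {K \<in> dyadic. K \<subset> J}"
      unfolding sweep_val_def using summable_mult_haar_val[OF summ] IJ by (intro has_sum_infsum) auto
    then have "((\<lambda>K. complex_of_real (haar_val I J) * (a K * complex_of_real (haar_val J K))) has_sum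
        (complex_of_real (haar_val I J) * sweep_val a J)) {K \<in> dyadic. K \<subset> J}"
      by (rule has_sum_cmult_right)
    then show ?thesis
      unfolding mult.commute[of "sweep_val a J"]
    proof (rule has_sum_cong_neutral[THEN iffD1, rotated -1])
      fix K assume "K \<in> dyadic - {K \<in> dyadic. K \<subset> J}"
      then show "a K * complex_of_real (haar_val I K) * complex_of_real (haar_val J K) = 0"
        using haar_val_eq_0[of K J] IJ by auto
    next
      fix K assume "K \<in> {K \<in> dyadic. K \<subset> J} \<inter> dyadic"
      then show "complex_of_real (haar_val I J) * (a K * complex_of_real (haar_val J K)) =
          a K * complex_of_real (haar_val I K) * complex_of_real (haar_val J K)"
        using haar_val_mono[of K J I] IJ by auto
    qed auto
  qed
  consider "I = J" | "J \<subset> I" | "I \<subset> J" | "I \<inter> J = {}" "I \<noteq> J"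
    using dyadic_nested[OF IJ] by blast
  then show ?thesis
  proof cases
    case 1
    \<comment> \<open>On the diagonal the product of the two Haar values is \<open>1 / len J\<close>
      on proper subintervals and zero elsewhere.\<close>
    have "(a has_sum infsum a {K \<in> dyadic. K \<subset> J}) {K \<in> dyadic. K \<subset> J}"
      using summ IJ by (intro has_sum_infsum) auto
    then have "((\<lambda>K. (1 / complex_of_real (len J)) * a K) has_sum
        ((1 / complex_of_real (len J)) * infsum a {K \<in> dyadic. K \<subset> J})) {K \<in> dyadic. K \<subset> J}"
      by (rule has_sum_cmult_right)
    then have "((\<lambda>K. a K * complex_of_real (haar_val J K) * complex_of_real (haar_val J K)) has_sum
        ((1 / complex_of_real (len J)) * infsum a {K \<in> dyadic. K \<subset> J})) dyadic"
    proof (rule has_sum_cong_neutral[THEN iffD1, rotated -1])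
      fix K assume "K \<in> dyadic - {K \<in> dyadic. K \<subset> J}"
      then show "a K * complex_of_real (haar_val J K) * complex_of_real (haar_val J K) = 0"
        using haar_val_eq_0[of K J] IJ by auto
    next
      fix K assume K: "K \<in> {K \<in> dyadic. K \<subset> J} \<inter> dyadic"
      then have "complex_of_real (haar_val J K * haar_val J K) = complex_of_real (1 / len J)"
        using haar_val_sq[of K J] IJ by auto
      then show "(1 / complex_of_real (len J)) * a K =
          a K * complex_of_real (haar_val J K) * complex_of_real (haar_val J K)"
        by (simp add: mult.assoc)
    qed auto
    moreover have "haar_val J J = 0" using haar_val_eq_0[of J J] IJ by auto
    ultimately show ?thesis using 1 by (simp add: diag_val_def)
  next
    case 2
    moreover have "haar_val J I = 0" using 2 haar_val_eq_0[of I J] IJ by auto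
    ultimately show ?thesis using sub[OF IJ] by auto
  next
    case 3
    moreover have "haar_val I J = 0" using 3 haar_val_eq_0[of J I] IJ by auto
    ultimately show ?thesis using sub[OF IJ(2,1)] by (auto simp: mult.assoc mult.left_commute mult.commute)
  next
    case 4
    have "haar_val I J = 0" "haar_val J I = 0"
      using 4 haar_val_eq_0[of I J] haar_val_eq_0[of J I] IJ dyadic_nonempty by blast+
    moreover have "a K * complex_of_real (haar_val I K) * complex_of_real (haar_val J K) = 0"
      if K: "K \<in> dyadic" for K
    proof -
      have "\<not> (K \<subset> I \<and> K \<subset> J)" using 4 dyadic_nonempty[OF K] by blast
      then show ?thesis using haar_val_eq_0[OF K] IJ by auto
    qed
    ultimately show ?thesis using 4 by (simp add: has_sum_0)
  qed
qed

section \<open>The operator of a symbol with Carleson sweep and bounded diagonal\<close>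

lemma L2_set_le_iff: "0 \<le> B \<Longrightarrow> L2_set f A \<le> B \<longleftrightarrow> (\<Sum>i\<in>A. (f i)\<^sup>2) \<le> B\<^sup>2"
  unfolding L2_set_def by (metis real_sqrt_le_iff real_sqrt_unique)

text \<open>The meeting point of both directions. Finite norms of the sequences, as well as a
  bounded realization, yield these hypotheses; from them follow both the operator and the bounds on
  the norms of the sequences.\<close>

locale bounded_symbol =
  fixes a :: "real set \<Rightarrow> complex" and M N :: real
  assumes summ: "\<And>I. I \<in> dyadic \<Longrightarrow> a summable_on {K \<in> dyadic. K \<subset> I}"
    and M: "0 \<le> M" and N: "0 \<le> N"
    and carleson: "\<And>I F. I \<in> dyadic \<Longrightarrow> finite F \<Longrightarrow> F \<subseteq> {J \<in> dyadic. J \<subseteq> I} \<Longrightarrow>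
      (\<Sum>J\<in>F. (cmod (sweep_val a J))\<^sup>2) \<le> M\<^sup>2 * len I"
    and diag: "\<And>I. I \<in> dyadic \<Longrightarrow> cmod (diag_val a I) \<le> N"
begin

text \<open>The Haar coefficients of \<open>P\<^sub>S\<^sup>(\<^sup>1\<^sup>,\<^sup>0\<^sup>) f\<close>, where \<open>S\<close> is the sweep.\<close>

definition adj :: "(real \<Rightarrow> complex) \<Rightarrow> real set \<Rightarrow> complex" where
  "adj f J = (\<Sum>\<^sub>\<infinity>I\<in>dyadic. sweep_val a I * complex_of_real (haar_val J I) * L2_inner f (haar 0 I))"

text \<open>The summands are the coefficients of the three operators into which the matrix splits;
  \<open>coeff_haar\<close> recovers the matrix.\<close>

definition coeff :: "(real \<Rightarrow> complex) \<Rightarrow> real set \<Rightarrow> complex" where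
  "coeff f J = sweep_val a J * L2_inner f (haar 1 J) + diag_val a J * L2_inner f (haar 0 J) + adj f J"

text \<open>Carleson embedding with the squared moduli of the sweep as weights and
  \<open>Q = M\<^sup>2\<close>; the square root turns \<open>4 * M\<^sup>2\<close> into
  \<open>2 * M\<close>.\<close>

lemma carleson_L2:
  assumes "f \<in> L2" "finite F" "F \<subseteq> dyadic"
  shows "L2_set (\<lambda>J. cmod (sweep_val a J * L2_inner f (haar 1 J))) F \<le> 2 * M * L2_norm f"
proof -
  have "(\<Sum>J\<in>F. (cmod (sweep_val a J))\<^sup>2 * (cmod (L2_inner f (haar 1 J)))\<^sup>2) \<le> 4 * M\<^sup>2 * (L2_norm f)\<^sup>2"
    using assms carleson by (intro carleson_embedding) auto
  then show ?thesis
    using M by (subst L2_set_le_iff) (auto simp: norm_mult power_mult_distrib)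
qed

text \<open>Only \<open>I\<close> properly inside \<open>J\<close> contribute, and there
  \<open>haar_val J I\<close> has square \<open>1 / len J\<close>. The Carleson condition on
  \<open>J\<close> and Bessel's inequality make both factors square summable.\<close>

lemma adj_summable:
  assumes f: "f \<in> L2" and J: "J \<in> dyadic"
  shows "(\<lambda>I. sweep_val a I * complex_of_real (haar_val J I) * L2_inner f (haar 0 I)) summable_on dyadic"
proof -
  let ?t = "\<lambda>I. sweep_val a I * complex_of_real (haar_val J I) * L2_inner f (haar 0 I)"
  have "(\<Sum>I\<in>F. cmod (?t I)) \<le> M\<^sup>2 + (L2_norm f)\<^sup>2" if F: "F \<subseteq> dyadic" "finite F" for F
  proof -
    have "(\<Sum>I\<in>F. cmod (?t I)) \<le>
        (\<Sum>I\<in>F. (cmod (sweep_val a I) * haar_val J I)\<^sup>2 + (cmod (L2_inner f (haar 0 I)))\<^sup>2)"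
    proof (rule sum_mono)
      fix I
      have "x * y \<le> x\<^sup>2 + y\<^sup>2" if "0 \<le> x" "0 \<le> y" for x y :: real
        using sum_squares_bound[of x y] mult_nonneg_nonneg[OF that] by linarith
      from this[of "cmod (sweep_val a I) * \<bar>haar_val J I\<bar>" "cmod (L2_inner f (haar 0 I))"]
      show "cmod (?t I) \<le> (cmod (sweep_val a I) * haar_val J I)\<^sup>2 + (cmod (L2_inner f (haar 0 I)))\<^sup>2"
        by (simp add: norm_mult power_mult_distrib)
    qed
    also have "\<dots> = (\<Sum>I\<in>F. (cmod (sweep_val a I) * haar_val J I)\<^sup>2) + (\<Sum>I\<in>F. (cmod (L2_inner f (haar 0 I)))\<^sup>2)"
      by (rule sum.distrib)
    also have "(\<Sum>I\<in>F. (cmod (sweep_val a I) * haar_val J I)\<^sup>2) =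
        (\<Sum>I\<in>{I \<in> F. I \<subset> J}. (cmod (sweep_val a I))\<^sup>2 / len J)"
    proof (rule sum.mono_neutral_cong_right)
      show "(cmod (sweep_val a I) * haar_val J I)\<^sup>2 = (cmod (sweep_val a I))\<^sup>2 / len J"
        if "I \<in> {I \<in> F. I \<subset> J}" for I
        using haar_val_sq[of I J] that F J by (auto simp: power_mult_distrib power2_eq_square[of "haar_val J I"])
      show "\<forall>I\<in>F - {I \<in> F. I \<subset> J}. (cmod (sweep_val a I) * haar_val J I)\<^sup>2 = 0"
        using haar_val_eq_0[of _ J] F J by auto
    qed (use F in auto)
    also have "\<dots> \<le> M\<^sup>2"
      using carleson[OF J, of "{I \<in> F. I \<subset> J}"] len_pos[OF J] F
      by (auto simp: sum_divide_distrib[symmetric] divide_le_eq)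
    finally show ?thesis using haar_bessel[OF F(2,1) f] by linarith
  qed
  then have "(\<lambda>I. cmod (?t I)) summable_on dyadic"
    unfolding Infinite_Sum.abs_summable_iff_bdd_above by (intro bdd_aboveI2) auto
  then show ?thesis by (rule Infinite_Sum.abs_summable_summable)
qed

text \<open>By duality from \<open>carleson_L2\<close>.\<close>

lemma adj_L2:
  assumes f: "f \<in> L2" and F: "finite F" "F \<subseteq> dyadic"
  shows "L2_set (\<lambda>J. cmod (adj f J)) F \<le> 2 * M * L2_norm f"
proof -
  \<comment> \<open>The test function has the coefficients under study, so pairing with it produces
    their squared sum \<open>X\<close>.\<close>
  let ?g = "\<lambda>x. \<Sum>J\<in>F. adj f J * haar 0 J x"
  define X where "X = (\<Sum>J\<in>F. (cmod (adj f J))\<^sup>2)"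
  have X0: "0 \<le> X" by (simp add: X_def sum_nonneg)
  have g: "?g \<in> L2" using F by (intro L2_sum L2_cmult) auto
  have gX: "L2_norm ?g = sqrt X"
    using haar_sum_norm_sq[OF F, of "adj f"] by (metis X_def L2_norm_nonneg real_sqrt_unique)
  let ?t = "\<lambda>I. L2_inner f (haar 0 I) * (sweep_val a I * L2_inner (haar 1 I) ?g)"
  have "((\<lambda>I. \<Sum>J\<in>F. cnj (adj f J) * (sweep_val a I * complex_of_real (haar_val J I) * L2_inner f (haar 0 I)))
      has_sum (\<Sum>J\<in>F. cnj (adj f J) * adj f J)) dyadic"
    unfolding adj_def using F adj_summable[OF f]
    by (intro has_sum_sum has_sum_cmult_right has_sum_infsum) auto
  also have "(\<lambda>I. \<Sum>J\<in>F. cnj (adj f J) * (sweep_val a I * complex_of_real (haar_val J I) * L2_inner f (haar 0 I)))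
      = (\<lambda>I. L2_inner f (haar 0 I) * (sweep_val a I * (\<Sum>J\<in>F. cnj (adj f J) * complex_of_real (haar_val J I))))"
    by (simp add: sum_distrib_left algebra_simps)
  also have "(\<Sum>J\<in>F. cnj (adj f J) * adj f J) = complex_of_real X"
    unfolding X_def of_real_sum complex_norm_square by (simp add: mult.commute)
  finally have "((\<lambda>I. L2_inner f (haar 0 I) * (sweep_val a I * (\<Sum>J\<in>F. cnj (adj f J) * complex_of_real (haar_val J I))))
      has_sum complex_of_real X) dyadic" .
  moreover have "L2_inner (haar 1 I) ?g = (\<Sum>J\<in>F. cnj (adj f J) * complex_of_real (haar_val J I))"
    if "I \<in> dyadic" for I
    using L2_inner_sum_right[of F "\<lambda>J. haar 0 J" "haar 1 I" "adj f"] F that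
    by (simp add: haar_1_haar_0 subset_iff)
  ultimately have "(?t has_sum complex_of_real X) dyadic"
    by (subst has_sum_cong) auto
  then have "(sum ?t \<longlongrightarrow> complex_of_real X) (finite_subsets_at_top dyadic)"
    by (simp add: has_sum_def)
  then have "((\<lambda>G. cmod (sum ?t G)) \<longlongrightarrow> cmod (complex_of_real X)) (finite_subsets_at_top dyadic)"
    by (rule tendsto_norm)
  \<comment> \<open>Cauchy-Schwarz on each finite partial sum, with Bessel for \<open>f\<close> and
    \<open>carleson_L2\<close> for \<open>?g\<close>; the bound then passes to the limit
    \<open>X\<close>.\<close>
  moreover have "\<forall>\<^sub>F G in finite_subsets_at_top dyadic. cmod (sum ?t G) \<le> L2_norm f * (2 * M * sqrt X)"
  proof (rule eventually_finite_subsets_at_top_weakI)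
    fix G assume G: "finite G" "G \<subseteq> dyadic"
    have "cmod (sum ?t G) \<le> (\<Sum>I\<in>G. \<bar>cmod (L2_inner f (haar 0 I))\<bar> * \<bar>cmod (sweep_val a I * L2_inner (haar 1 I) ?g)\<bar>)"
      by (rule order_trans[OF norm_sum]) (simp add: norm_mult)
    also have "\<dots> \<le> L2_set (\<lambda>I. cmod (L2_inner f (haar 0 I))) G *
        L2_set (\<lambda>I. cmod (sweep_val a I * L2_inner (haar 1 I) ?g)) G"
      by (rule L2_set_mult_ineq)
    also have "\<dots> \<le> L2_norm f * (2 * M * sqrt X)"
    proof (intro mult_mono)
      show "L2_set (\<lambda>I. cmod (L2_inner f (haar 0 I))) G \<le> L2_norm f"
        by (subst L2_set_le_iff) (auto intro: haar_bessel[OF G f])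
      have "cmod (L2_inner (haar 1 I) ?g) = cmod (L2_inner ?g (haar 1 I))" for I
        by (subst L2_inner_cnj[symmetric]) (rule complex_mod_cnj)
      then show "L2_set (\<lambda>I. cmod (sweep_val a I * L2_inner (haar 1 I) ?g)) G \<le> 2 * M * sqrt X"
        using carleson_L2[OF g G] gX by (simp add: norm_mult)
    qed auto
    finally show "cmod (sum ?t G) \<le> L2_norm f * (2 * M * sqrt X)" .
  qed
  ultimately have "cmod (complex_of_real X) \<le> L2_norm f * (2 * M * sqrt X)"
    by (intro tendsto_upperbound) auto
  then have "sqrt X * sqrt X \<le> (2 * M * L2_norm f) * sqrt X"
    using X0 by (simp add: mult_ac)
  then have "sqrt X \<le> 2 * M * L2_norm f"
    using X0 M mult_right_le_imp_le[of "sqrt X" "sqrt X" "2 * M * L2_norm f"] by (cases "X = 0") auto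
  then show ?thesis by (simp add: L2_set_def X_def)
qed

text \<open>Minkowski's inequality for finite sequences: each of the two sweep terms contributes
  \<open>2 * M\<close>, the diagonal \<open>N\<close>.\<close>

lemma coeff_L2:
  assumes f: "f \<in> L2" and F: "finite F" "F \<subseteq> dyadic"
  shows "(\<Sum>J\<in>F. (cmod (coeff f J))\<^sup>2) \<le> ((4 * M + N) * L2_norm f)\<^sup>2"
proof -
  let ?u = "\<lambda>J. cmod (sweep_val a J * L2_inner f (haar 1 J))"
  let ?v = "\<lambda>J. cmod (diag_val a J * L2_inner f (haar 0 J))"
  let ?w = "\<lambda>J. cmod (adj f J)"
  have v: "L2_set ?v F \<le> N * L2_norm f"
  proof -
    have "L2_set ?v F \<le> L2_set (\<lambda>J. N * cmod (L2_inner f (haar 0 J))) F"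
      using F diag by (intro L2_set_mono) (auto simp: norm_mult intro!: mult_right_mono)
    also have "\<dots> = N * L2_set (\<lambda>J. cmod (L2_inner f (haar 0 J))) F"
      using N by (simp add: L2_set_right_distrib)
    also have "\<dots> \<le> N * L2_norm f"
      using N haar_bessel[OF F f] by (intro mult_left_mono) (auto simp: L2_set_le_iff)
    finally show ?thesis .
  qed
  have "L2_set (\<lambda>J. cmod (coeff f J)) F \<le> L2_set (\<lambda>J. (?u J + ?v J) + ?w J) F"
    unfolding coeff_def by (intro L2_set_mono norm_triangle_le add_mono norm_triangle_ineq) auto
  also have "\<dots> \<le> L2_set (\<lambda>J. ?u J + ?v J) F + L2_set ?w F"
    by (rule L2_set_triangle_ineq)
  also have "\<dots> \<le> (L2_set ?u F + L2_set ?v F) + L2_set ?w F"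
    by (intro add_mono L2_set_triangle_ineq) auto
  also have "\<dots> \<le> (4 * M + N) * L2_norm f"
    using carleson_L2[OF f F] v adj_L2[OF f F] by (simp add: algebra_simps)
  finally show ?thesis
    using M N by (subst (asm) L2_set_le_iff) auto
qed

lemma coeff_linear:
  assumes f: "f \<in> L2" and g: "g \<in> L2" and J: "J \<in> dyadic"
  shows "coeff (\<lambda>x. c * f x + g x) J = c * coeff f J + coeff g J"
proof -
  have inner: "L2_inner (\<lambda>x. c * f x + g x) (haar \<alpha> I) = c * L2_inner f (haar \<alpha> I) + L2_inner g (haar \<alpha> I)"
    if "I \<in> dyadic" for \<alpha> I
    using that f g by (simp add: L2_inner_add_left L2_cmult L2_inner_cmult_left)
  have "adj (\<lambda>x. c * f x + g x) J = (\<Sum>\<^sub>\<infinity>I\<in>dyadic.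
      c * (sweep_val a I * complex_of_real (haar_val J I) * L2_inner f (haar 0 I)) +
      sweep_val a I * complex_of_real (haar_val J I) * L2_inner g (haar 0 I))"
    unfolding adj_def by (intro infsum_cong) (simp only: inner distrib_left mult_ac)
  also have "\<dots> = c * adj f J + adj g J"
    unfolding adj_def using adj_summable[OF f J] adj_summable[OF g J]
    by (subst infsum_add) (auto intro: summable_on_cmult_right simp: infsum_cmult_right')
  finally show ?thesis unfolding coeff_def inner[OF J] by (simp add: algebra_simps)
qed

lemma coeff_haar:
  assumes "I \<in> dyadic" "J \<in> dyadic"
  shows "coeff (haar 0 I) J = sweep_val a J * complex_of_real (haar_val I J) +
    (if I = J then diag_val a J else 0) + sweep_val a I * complex_of_real (haar_val J I)"
proof -
  have "((\<lambda>L. sweep_val a L * complex_of_real (haar_val J L) * L2_inner (haar 0 I) (haar 0 L))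
      has_sum (sweep_val a I * complex_of_real (haar_val J I))) dyadic"
    using assms by (intro has_sum_finite_neutralI[of "{I}"]) (auto simp: haar_orthonormal)
  then have "adj (haar 0 I) J = sweep_val a I * complex_of_real (haar_val J I)"
    unfolding adj_def by (rule infsumI)
  then show ?thesis
    using assms by (auto simp: coeff_def haar_orthonormal haar_0_haar_1)
qed

text \<open>Here the operator meets the paraproduct: the coefficients prescribed for the image of a
  Haar function are the sums of the paraproduct series tested on Haar functions.\<close>

lemma coeff_haar_has_sum:
  assumes "I \<in> dyadic" "J \<in> dyadic"
  shows "((\<lambda>K. a K * complex_of_real (haar_val I K) * complex_of_real (haar_val J K)) has_sum
    coeff (haar 0 I) J) dyadic"
  unfolding coeff_haar[OF assms] using summ assms by (rule haar_matrix_has_sum)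

lemma coeff_haar_sum:
  assumes "finite F" "F \<subseteq> dyadic" "J \<in> dyadic"
  shows "coeff (\<lambda>x. \<Sum>I\<in>F. c I * haar 0 I x) J = (\<Sum>I\<in>F. c I * coeff (haar 0 I) J)"
  using assms(1,2)
proof (induction F rule: finite_induct)
  case empty
  have "coeff (\<lambda>x. 0) J = 0"
    using coeff_linear[OF L2_zero L2_zero assms(3), of 1] by simp
  then show ?case by simp
next
  case (insert I F)
  have "coeff (\<lambda>x. \<Sum>I\<in>insert I F. c I * haar 0 I x) J =
      coeff (\<lambda>x. c I * haar 0 I x + (\<Sum>I\<in>F. c I * haar 0 I x)) J"
    using insert by simp
  also have "\<dots> = c I * coeff (haar 0 I) J + coeff (\<lambda>x. \<Sum>I\<in>F. c I * haar 0 I x) J"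
    using insert.prems assms(3) by (intro coeff_linear L2_sum L2_cmult) auto
  finally show ?case using insert by simp
qed

text \<open>The choice among expansions affects values only on a null set.\<close>

definition op :: "(real \<Rightarrow> complex) \<Rightarrow> real \<Rightarrow> complex" where
  "op f = (SOME g. haar_expansion (coeff f) g)"

lemma op_expansion: assumes "f \<in> L2" shows "haar_expansion (coeff f) (op f)"
proof -
  obtain g where "haar_expansion (coeff f) g"
    using haar_expansion_exists[of "coeff f", OF coeff_L2[OF assms]] .
  then show ?thesis unfolding op_def by (rule someI[where P = "haar_expansion (coeff f)"])
qed

lemma op_bounded_linear: "L2_bounded_linear op (4 * M + N)"
  unfolding L2_bounded_linear_def
proof (intro conjI ballI allI)
  fix f assume f: "f \<in> L2"
  show "op f \<in> L2" using op_expansion[OF f] by (simp add: haar_expansion_def)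
  have "(L2_norm (op f))\<^sup>2 \<le> ((4 * M + N) * L2_norm f)\<^sup>2"
    using op_expansion[OF f] coeff_L2[OF f] by (rule haar_expansion_norm_le)
  then show "L2_norm (op f) \<le> (4 * M + N) * L2_norm f"
    by (rule power2_le_imp_le) (simp add: M N)
next
  fix f g c assume fg: "f \<in> L2" "g \<in> L2"
  show "AE x in lborel. op (\<lambda>y. c * f y + g y) x = c * op f x + op g x"
  proof (rule haar_expansion_linear)
    show "haar_expansion (coeff f) (op f)" "haar_expansion (coeff g) (op g)"
      using fg by (auto intro: op_expansion)
    show "haar_expansion (coeff (\<lambda>y. c * f y + g y)) (op (\<lambda>y. c * f y + g y))"
      using fg by (intro op_expansion L2_add L2_cmult)
  qed (use fg coeff_linear in auto)
qed

text \<open>Both functions are finite Haar combinations, so each pairing involves finitely many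
  matrix entries, and the finite sums commute with the unconditional sum over
  \<open>K\<close>.\<close>

lemma op_realizes: "realizes op (paraproduct a 1 1)"
  unfolding realizes_def paraproduct_def
proof (intro ballI)
  fix f \<phi> assume f: "f \<in> haar_span" and \<phi>: "\<phi> \<in> haar_span"
  from f obtain F c where F: "finite F" "F \<subseteq> dyadic" and f_eq: "f = (\<lambda>x. \<Sum>I\<in>F. c I * haar 0 I x)"
    by (auto simp: haar_span_def)
  from \<phi> obtain G e where G: "finite G" "G \<subseteq> dyadic" and \<phi>_eq: "\<phi> = (\<lambda>x. \<Sum>I\<in>G. e I * haar 0 I x)"
    by (auto simp: haar_span_def)
  note fL = haar_span_L2[OF f] and opL = op_bounded_linear[unfolded L2_bounded_linear_def]
  have "L2_inner (op f) \<phi> = (\<Sum>J\<in>G. cnj (e J) * L2_inner (op f) (haar 0 J))"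
    unfolding \<phi>_eq using G opL fL by (intro L2_inner_sum_right) auto
  also have "\<dots> = (\<Sum>J\<in>G. cnj (e J) * (\<Sum>I\<in>F. c I * coeff (haar 0 I) J))"
    using G haar_expansion_coeff[OF op_expansion[OF fL]] coeff_haar_sum[OF F, of _ c]
    by (intro sum.cong) (auto simp: f_eq)
  finally have inner: "L2_inner (op f) \<phi> = (\<Sum>J\<in>G. cnj (e J) * (\<Sum>I\<in>F. c I * coeff (haar 0 I) J))" .
  have "((\<lambda>K. \<Sum>J\<in>G. cnj (e J) * (\<Sum>I\<in>F. c I * (a K * complex_of_real (haar_val I K) * complex_of_real (haar_val J K))))
      has_sum L2_inner (op f) \<phi>) dyadic"
    unfolding inner using F G by (intro has_sum_sum has_sum_cmult_right coeff_haar_has_sum) auto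
  moreover have "a K * L2_inner f (haar 1 K) * L2_inner (haar 1 K) \<phi> =
      (\<Sum>J\<in>G. cnj (e J) * (\<Sum>I\<in>F. c I * (a K * complex_of_real (haar_val I K) * complex_of_real (haar_val J K))))"
    if K: "K \<in> dyadic" for K
  proof -
    have fK: "L2_inner f (haar 1 K) = (\<Sum>I\<in>F. c I * complex_of_real (haar_val I K))"
      unfolding f_eq using F K L2_inner_sum_left[of F "\<lambda>I. haar 0 I" "haar 1 K" c]
      by (simp add: haar_0_haar_1 subset_iff)
    have \<phi>K: "L2_inner (haar 1 K) \<phi> = (\<Sum>J\<in>G. cnj (e J) * complex_of_real (haar_val J K))"
      unfolding \<phi>_eq using G K L2_inner_sum_right[of G "\<lambda>I. haar 0 I" "haar 1 K" e]
      by (simp add: haar_1_haar_0 subset_iff)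
    have inner_sum: "(\<Sum>I\<in>F. c I * (a K * complex_of_real (haar_val I K) * complex_of_real (haar_val J K))) =
        a K * L2_inner f (haar 1 K) * complex_of_real (haar_val J K)" for J
      by (simp add: fK sum_distrib_left sum_distrib_right mult_ac)
    show ?thesis
      unfolding \<phi>K inner_sum sum_distrib_left by (intro sum.cong refl) (simp only: mult_ac)
  qed
  ultimately show "((\<lambda>K. a K * L2_inner f (haar 1 K) * L2_inner (haar 1 K) \<phi>) has_sum L2_inner (op f) \<phi>) dyadic"
    by (subst has_sum_cong) auto
qed

end

subsection \<open>Comparison of the norms\<close>

text \<open>Testing the intermediate generalised function on \<open>haar 0 I\<close> isolates one
  term of its series, so its value there is \<open>d I * u (haar 1 I)\<close>, and the outer series
  uses only these values. Equality of the relations makes the equality of the operator norms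
  immediate.\<close>

lemma composition_paraproduct:
  "composition (paraproduct b 1 0) (paraproduct d 0 1) = paraproduct (schur b d) 1 1"
proof (intro ext iffI)
  fix u v assume "composition (paraproduct b 1 0) (paraproduct d 0 1) u v"
  then obtain w where w: "paraproduct d 0 1 u w" "paraproduct b 1 0 w v"
    by (auto simp: composition_def)
  have "w (haar 0 I) = d I * u (haar 1 I)" if I: "I \<in> dyadic" for I
  proof -
    have "((\<lambda>K. d K * u (haar 1 K) * L2_inner (haar 0 K) (haar 0 I)) has_sum w (haar 0 I)) dyadic"
      using w(1) haar_in_haar_span[OF I] by (simp add: paraproduct_def)
    moreover have "((\<lambda>K. d K * u (haar 1 K) * L2_inner (haar 0 K) (haar 0 I)) has_sum d I * u (haar 1 I)) dyadic"
      using I by (intro has_sum_finite_neutralI[of "{I}"]) (auto simp: haar_orthonormal)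
    ultimately show ?thesis by (metis infsumI)
  qed
  then have "b I * w (haar 0 I) = schur b d I * u (haar 1 I)" if "I \<in> dyadic" for I
    using that by (simp add: schur_def)
  then show "paraproduct (schur b d) 1 1 u v"
    using w(2) unfolding paraproduct_def by (simp cong: has_sum_cong)
next
  fix u v assume v: "paraproduct (schur b d) 1 1 u v"
  let ?t = "\<lambda>\<phi> K. d K * u (haar 1 K) * L2_inner (haar 0 K) \<phi>"
  \<comment> \<open>Against a finite Haar combination only finitely many terms are nonzero, so this
    \<open>infsum\<close> is a genuine sum.\<close>
  define w where "w \<phi> = infsum (?t \<phi>) dyadic" for \<phi>
  have w1: "paraproduct d 0 1 u w"
    unfolding paraproduct_def w_def
  proof (intro ballI has_sum_infsum)
    fix \<phi> assume "\<phi> \<in> haar_span"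
    then obtain G e where G: "finite G" "G \<subseteq> dyadic" and \<phi>: "\<phi> = (\<lambda>x. \<Sum>I\<in>G. e I * haar 0 I x)"
      by (auto simp: haar_span_def)
    have "L2_inner (haar 0 K) \<phi> = 0" if "K \<in> dyadic - G" for K
      using haar_sum_inner[OF G, of K e] that L2_inner_cnj[of \<phi> "haar 0 K"] by (simp add: \<phi>)
    then have "(?t \<phi> has_sum (\<Sum>K\<in>G. ?t \<phi> K)) dyadic"
      using G by (intro has_sum_finite_neutralI[of G]) auto
    then show "?t \<phi> summable_on dyadic" by (auto simp: summable_on_def)
  qed
  have "w (haar 0 I) = d I * u (haar 1 I)" if I: "I \<in> dyadic" for I
  proof -
    have "(?t (haar 0 I) has_sum d I * u (haar 1 I)) dyadic"
      using I by (intro has_sum_finite_neutralI[of "{I}"]) (auto simp: haar_orthonormal)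
    then show ?thesis unfolding w_def by (rule infsumI)
  qed
  then have "schur b d I * u (haar 1 I) = b I * w (haar 0 I)" if "I \<in> dyadic" for I
    using that by (simp add: schur_def)
  then have "paraproduct b 1 0 w v"
    using v unfolding paraproduct_def by (simp cong: has_sum_cong)
  then show "composition (paraproduct b 1 0) (paraproduct d 0 1) u v"
    using w1 by (auto simp: composition_def)
qed

text \<open>The constant in \<open>bounded_on_L2\<close> may be negative while
  \<open>L2_op_norm\<close> asks for \<open>0 \<le> C\<close>; \<open>max C 0\<close> reconciles
  them.\<close>

lemma bounded_on_L2_iff: "bounded_on_L2 P \<longleftrightarrow> L2_op_norm P < \<infinity>"
proof
  assume "bounded_on_L2 P"
  then obtain T C where T: "L2_bounded_linear T C" "realizes T P"
    by (auto simp: bounded_on_L2_def)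
  have "C * L2_norm f \<le> max C 0 * L2_norm f" for f
    by (intro mult_right_mono) auto
  then have "L2_bounded_linear T (max C 0)"
    using T(1) unfolding L2_bounded_linear_def by (meson order_trans)
  then have "L2_op_norm P \<le> ennreal (max C 0)"
    unfolding L2_op_norm_def using T(2) by (intro Inf_lower) auto
  then show "L2_op_norm P < \<infinity>"
    by (simp add: order_le_less_trans)
next
  assume "L2_op_norm P < \<infinity>"
  then show "bounded_on_L2 P"
    unfolding L2_op_norm_def bounded_on_L2_def by (auto simp: Inf_less_iff)
qed

section \<open>The norms of the sweep and of the averages\<close>

lemma ennreal_sqrt_le_iff: "0 \<le> M \<Longrightarrow> ennreal_sqrt x \<le> ennreal M \<longleftrightarrow> x \<le> ennreal (M\<^sup>2)"
  by (cases x) (auto simp: ennreal_sqrt_def top_unique real_sqrt_le_iff' sqrt_le_D real_le_lsqrt)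

lemma ennreal_divide_le_iff: "0 < l \<Longrightarrow> 0 \<le> B \<Longrightarrow> x / ennreal l \<le> ennreal B \<longleftrightarrow> x \<le> ennreal (B * l)"
  by (cases x) (auto simp: divide_ennreal divide_le_eq ennreal_top_divide top_unique)

text \<open>Reduces the extended infinite sums to finite families, the form of the Carleson
  condition in \<open>bounded_symbol\<close>.\<close>

lemma CM_norm_le_iff:
  assumes "0 \<le> M"
  shows "CM_norm s \<le> ennreal M \<longleftrightarrow> (\<forall>I\<in>dyadic. \<forall>F. finite F \<longrightarrow> F \<subseteq> {J \<in> dyadic. J \<subseteq> I} \<longrightarrow>
    (\<Sum>J\<in>F. (abs_entry (s J))\<^sup>2) \<le> ennreal (M\<^sup>2 * len I))"
proof -
  have "CM_norm s \<le> ennreal M \<longleftrightarrow> (\<forall>I\<in>dyadic.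
      (\<Sum>\<^sub>\<infinity>J\<in>{J \<in> dyadic. J \<subseteq> I}. (abs_entry (s J))\<^sup>2) \<le> ennreal (M\<^sup>2 * len I))"
    unfolding CM_norm_def using assms
    by (simp add: ennreal_sqrt_le_iff SUP_le_iff ennreal_divide_le_iff cong: ball_cong)
  then show ?thesis
    by (auto simp: nonneg_infsum_complete SUP_le_iff)
qed

lemma sweep_eq:
  assumes "a summable_on {K \<in> dyadic. K \<subset> I}" "I \<in> dyadic"
  shows "sweep a I = Some (sweep_val a I)"
proof -
  have eq: "a K * L2_inner (haar 1 K) (haar 0 I) = a K * complex_of_real (haar_val I K)"
    if "K \<in> {K \<in> dyadic. K \<subset> I}" for K
    using that assms by (simp add: haar_1_haar_0)
  have "infsum (\<lambda>K. a K * L2_inner (haar 1 K) (haar 0 I)) {K \<in> dyadic. K \<subset> I} = sweep_val a I"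
    unfolding sweep_val_def using eq by (rule infsum_cong)
  moreover have "(\<lambda>K. a K * L2_inner (haar 1 K) (haar 0 I)) summable_on {K \<in> dyadic. K \<subset> I} \<longleftrightarrow>
      (\<lambda>K. a K * complex_of_real (haar_val I K)) summable_on {K \<in> dyadic. K \<subset> I}"
    using eq by (rule summable_on_cong)
  ultimately show ?thesis
    using summable_mult_haar_val[OF assms] by (simp add: sweep_def series_def)
qed

text \<open>Split the sum over proper subintervals at the midpoint: \<open>diag_val\<close> is the
  mean of the averages on the two halves, and \<open>sweep_val\<close> is their difference up to
  normalisation.\<close>

lemma E_seq_halves:
  assumes summ: "a summable_on {K \<in> dyadic. K \<subset> I}" and I: "I \<in> dyadic"
  shows "E_seq a (right_half I) = Some (diag_val a I + sweep_val a I / complex_of_real (sqrt (len I)))"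
    and "E_seq a (left_half I) = Some (diag_val a I - sweep_val a I / complex_of_real (sqrt (len I)))"
proof -
  let ?R = "{K \<in> dyadic. K \<subseteq> right_half I}" and ?L = "{K \<in> dyadic. K \<subseteq> left_half I}"
  note un = descendants_halves[OF I]
  have sR: "a summable_on ?R" and sL: "a summable_on ?L"
    using summable_on_subset_banach[OF summ] un(1) by auto
  \<comment> \<open>With the square root of the length as variable all identities become rational;
    each half has length \<open>l * l / 2\<close>.\<close>
  define l where "l = complex_of_real (sqrt (len I))"
  have l: "l * l = complex_of_real (len I)" "l \<noteq> 0"
    using len_pos[OF I] by (auto simp: l_def simp flip: of_real_mult)
  have D: "diag_val a I = (infsum a ?L + infsum a ?R) / (l * l)"
    unfolding diag_val_def un(1) l(1) using infsum_Un_disjoint[OF sL sR un(2)] by simp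
  have "infsum (\<lambda>K. a K * complex_of_real (haar_val I K)) ?L = infsum (\<lambda>K. a K * (- 1 / l)) ?L"
    by (intro infsum_cong) (auto simp: haar_val_left l_def)
  moreover have "infsum (\<lambda>K. a K * complex_of_real (haar_val I K)) ?R = infsum (\<lambda>K. a K * (1 / l)) ?R"
    by (intro infsum_cong) (auto simp: haar_val_right l_def)
  ultimately have S: "sweep_val a I = infsum a ?L * (- 1 / l) + infsum a ?R * (1 / l)"
    unfolding sweep_val_def un(1)
    using infsum_Un_disjoint[OF summable_mult_haar_val[OF sL I] summable_mult_haar_val[OF sR I] un(2)]
    by (simp only: infsum_cmult_left')
  have "E_seq a (right_half I) = Some (infsum a ?R / (l * l / 2))"
    using sR by (simp add: E_seq_def series_def l len_right_half[OF I])
  also have "infsum a ?R / (l * l / 2) = diag_val a I + sweep_val a I / l"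
    unfolding D S using l(2) by (simp add: field_simps)
  finally show "E_seq a (right_half I) = Some (diag_val a I + sweep_val a I / complex_of_real (sqrt (len I)))"
    by (simp only: l_def)
  have "E_seq a (left_half I) = Some (infsum a ?L / (l * l / 2))"
    using sL by (simp add: E_seq_def series_def l len_left_half[OF I])
  also have "infsum a ?L / (l * l / 2) = diag_val a I - sweep_val a I / l"
    unfolding D S using l(2) by (simp add: field_simps)
  finally show "E_seq a (left_half I) = Some (diag_val a I - sweep_val a I / complex_of_real (sqrt (len I)))"
    by (simp only: l_def)
qed

lemma sum_abs_entry_Some:
  "(\<Sum>J\<in>F. (abs_entry (Some (w J)))\<^sup>2) = ennreal (\<Sum>J\<in>F. (cmod (w J))\<^sup>2)"
  by (simp add: abs_entry_def ennreal_power sum_ennreal)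

lemma (in bounded_symbol) CM_norm_sweep_le: "CM_norm (sweep a) \<le> ennreal M"
  unfolding CM_norm_le_iff[OF M]
proof (intro ballI allI impI)
  fix I F assume I: "I \<in> dyadic" and F: "finite F" "F \<subseteq> {J \<in> dyadic. J \<subseteq> I}"
  have "(\<Sum>J\<in>F. (abs_entry (sweep a J))\<^sup>2) = (\<Sum>J\<in>F. (abs_entry (Some (sweep_val a J)))\<^sup>2)"
    using F summ by (intro sum.cong) (auto simp: sweep_eq)
  then show "(\<Sum>J\<in>F. (abs_entry (sweep a J))\<^sup>2) \<le> ennreal (M\<^sup>2 * len I)"
    using carleson[OF I F] by (simp add: sum_abs_entry_Some ennreal_leI)
qed

text \<open>Every interval is a half of its parent \<open>P\<close>, and the Carleson condition on
  the single interval \<open>P\<close> bounds the sweep correction by \<open>M\<close>.\<close>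

lemma (in bounded_symbol) linf_norm_E_le: "linf_norm (E_seq a) \<le> ennreal (M + N)"
  unfolding linf_norm_def
proof (rule SUP_least)
  fix I assume "I \<in> dyadic"
  then obtain P where P: "P \<in> dyadic" and half: "I = left_half P \<or> I = right_half P"
    by (rule dyadic_parentE)
  let ?q = "sweep_val a P / complex_of_real (sqrt (len P))"
  have "(cmod (sweep_val a P))\<^sup>2 \<le> (M * sqrt (len P))\<^sup>2"
    using carleson[OF P, of "{P}"] P len_pos[OF P] by (simp add: power_mult_distrib)
  then have "cmod (sweep_val a P) \<le> M * sqrt (len P)"
    by (rule power2_le_imp_le) (use M len_pos[OF P] in simp)
  then have "cmod ?q \<le> M"
    using len_pos[OF P] by (simp add: norm_divide divide_le_eq)
  then have "cmod (diag_val a P - ?q) \<le> M + N" "cmod (diag_val a P + ?q) \<le> M + N"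
    using diag[OF P] norm_triangle_ineq[of "diag_val a P" ?q] norm_triangle_ineq4[of "diag_val a P" ?q]
    by linarith+
  then show "abs_entry (E_seq a I) \<le> ennreal (M + N)"
    using half E_seq_halves[OF summ[OF P] P] by (auto simp: abs_entry_def intro: ennreal_leI)
qed

lemma bounded_symbol_if_norms_le:
  assumes CM: "CM_norm (sweep a) \<le> ennreal M" and E: "linf_norm (E_seq a) \<le> ennreal N"
    and MN: "0 \<le> M" "0 \<le> N"
  shows "bounded_symbol a M N"
proof
  have E_le: "abs_entry (E_seq a I) \<le> ennreal N" if "I \<in> dyadic" for I
    using E that unfolding linf_norm_def SUP_le_iff by blast
  show summ: "a summable_on {K \<in> dyadic. K \<subset> I}" if I: "I \<in> dyadic" for I
  proof -
    \<comment> \<open>A divergent entry counts as infinite, so a finite norm forces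
      convergence.\<close>
    have "E_seq a I \<noteq> None"
      using E_le[OF I] by (cases "E_seq a I") (auto simp: abs_entry_def top_unique)
    then have "a summable_on {K \<in> dyadic. K \<subseteq> I}"
      by (auto simp: E_seq_def series_def split: if_splits)
    then show ?thesis by (rule summable_on_subset_banach) auto
  qed
  show "(\<Sum>J\<in>F. (cmod (sweep_val a J))\<^sup>2) \<le> M\<^sup>2 * len I"
    if I: "I \<in> dyadic" and F: "finite F" "F \<subseteq> {J \<in> dyadic. J \<subseteq> I}" for I F
  proof -
    have "ennreal (\<Sum>J\<in>F. (cmod (sweep_val a J))\<^sup>2) = (\<Sum>J\<in>F. (abs_entry (sweep a J))\<^sup>2)"
      unfolding sum_abs_entry_Some[symmetric] using F summ by (intro sum.cong) (auto simp: sweep_eq)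
    also have "\<dots> \<le> ennreal (M\<^sup>2 * len I)"
      using CM I F unfolding CM_norm_le_iff[OF MN(1)] by blast
    finally show ?thesis using len_pos[OF I] by (subst (asm) ennreal_le_iff) auto
  qed
  show "cmod (diag_val a I) \<le> N" if I: "I \<in> dyadic" for I
  proof -
    \<comment> \<open>\<open>diag_val a I\<close> is the midpoint of the values of
      \<open>E_seq\<close> on the two halves, so it inherits the bound \<open>N\<close>
      unchanged.\<close>
    let ?q = "sweep_val a I / complex_of_real (sqrt (len I))"
    have "cmod (diag_val a I + ?q) \<le> N" "cmod (diag_val a I - ?q) \<le> N"
      using E_le[OF right_half_dyadic[OF I]] E_le[OF left_half_dyadic[OF I]]
        E_seq_halves[OF summ[OF I] I] MN by (auto simp: abs_entry_def)
    moreover have "cmod z \<le> N" if "cmod (z + q) \<le> N" "cmod (z - q) \<le> N" for z q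
    proof -
      have "(z + q) + (z - q) = 2 * z" by simp
      then have "2 * cmod z = cmod ((z + q) + (z - q))" by (simp only: norm_mult norm_numeral)
      then show ?thesis using norm_triangle_ineq[of "z + q" "z - q"] that by linarith
    qed
    ultimately show ?thesis by blast
  qed
qed (use MN in auto)

lemma bounded_symbol_if_realizes:
  assumes T: "L2_bounded_linear T C" "realizes T (paraproduct a 1 1)" and "0 \<le> C"
  shows "bounded_symbol a (sqrt 2 * C) C"
proof
  have TL: "T (haar 0 I) \<in> L2" and T_le: "(L2_norm (T (haar 0 I)))\<^sup>2 \<le> C\<^sup>2" if I: "I \<in> dyadic" for I
  proof -
    show "T (haar 0 I) \<in> L2" using T(1) I by (auto simp: L2_bounded_linear_def)
    have "L2_norm (T (haar 0 I)) \<le> C * L2_norm (haar 0 I)"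
      using T(1) I by (auto simp: L2_bounded_linear_def)
    then show "(L2_norm (T (haar 0 I)))\<^sup>2 \<le> C\<^sup>2"
      using I by (intro power_mono) (simp_all add: L2_norm_haar_0)
  qed
  have entry: "((\<lambda>K. a K * complex_of_real (haar_val I K) * complex_of_real (haar_val J K)) has_sum
      L2_inner (T (haar 0 I)) (haar 0 J)) dyadic" if IJ: "I \<in> dyadic" "J \<in> dyadic" for I J
  proof -
    have "((\<lambda>K. a K * L2_inner (haar 0 I) (haar 1 K) * L2_inner (haar 1 K) (haar 0 J)) has_sum
        L2_inner (T (haar 0 I)) (haar 0 J)) dyadic"
      using T(2) IJ haar_in_haar_span by (auto simp: realizes_def paraproduct_def)
    then show ?thesis
      using IJ by (simp add: haar_0_haar_1 haar_1_haar_0 cong: has_sum_cong)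
  qed
  show summ: "a summable_on {K \<in> dyadic. K \<subset> I}" if I: "I \<in> dyadic" for I
  proof -
    \<comment> \<open>In the diagonal entry the Haar factors equal the constant
      \<open>1 / len I\<close> below \<open>I\<close>, so its convergence gives that of the
      symbol.\<close>
    have "(\<lambda>K. a K * complex_of_real (haar_val I K) * complex_of_real (haar_val I K)) summable_on dyadic"
      using entry[OF I I] by (auto simp: summable_on_def)
    then have "(\<lambda>K. a K * complex_of_real (haar_val I K) * complex_of_real (haar_val I K)) summable_on {K \<in> dyadic. K \<subset> I}"
      by (rule summable_on_subset_banach) auto
    also have "?this \<longleftrightarrow> (\<lambda>K. a K * complex_of_real (1 / len I)) summable_on {K \<in> dyadic. K \<subset> I}"
    proof (rule summable_on_cong)
      fix K assume "K \<in> {K \<in> dyadic. K \<subset> I}"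
      then have "complex_of_real (haar_val I K * haar_val I K) = complex_of_real (1 / len I)"
        using haar_val_sq[of K I] I by auto
      then show "a K * complex_of_real (haar_val I K) * complex_of_real (haar_val I K) = a K * complex_of_real (1 / len I)"
        by (simp only: of_real_mult mult.assoc)
    qed
    finally show ?thesis
      using summable_on_cmult_left'[of "complex_of_real (1 / len I)" a] len_pos[OF I] by auto
  qed
  have matrix: "L2_inner (T (haar 0 I)) (haar 0 J) =
      sweep_val a J * complex_of_real (haar_val I J) + (if I = J then diag_val a J else 0) +
      sweep_val a I * complex_of_real (haar_val J I)" if IJ: "I \<in> dyadic" "J \<in> dyadic" for I J
    using infsumI[OF entry[OF IJ]] infsumI[OF haar_matrix_has_sum[OF summ IJ]] by simp
  show "cmod (diag_val a I) \<le> C" if I: "I \<in> dyadic" for I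
  proof -
    have "diag_val a I = L2_inner (T (haar 0 I)) (haar 0 I)"
      using matrix[OF I I] haar_val_eq_0[OF I I] by simp
    then have "(cmod (diag_val a I))\<^sup>2 \<le> C\<^sup>2"
      using order_trans[OF haar_bessel[of "{I}" "T (haar 0 I)"] T_le[OF I]] TL[OF I] I by simp
    then show ?thesis using \<open>0 \<le> C\<close> by (rule power2_le_imp_le)
  qed
  show "(\<Sum>J\<in>F. (cmod (sweep_val a J))\<^sup>2) \<le> (sqrt 2 * C)\<^sup>2 * len I"
    if I: "I \<in> dyadic" and F: "finite F" "F \<subseteq> {J \<in> dyadic. J \<subseteq> I}" for I F
  proof -
    \<comment> \<open>Passing to the parent makes \<open>I\<close> itself, like every
      \<open>J\<close> in \<open>F\<close>, a proper subinterval; \<open>len P = 2 * len I\<close>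
      is the origin of \<open>sqrt 2\<close>.\<close>
    obtain P where P: "P \<in> dyadic" and half: "I = left_half P \<or> I = right_half P"
      using I by (rule dyadic_parentE)
    have lP: "len P = 2 * len I"
      using half len_left_half[OF P] len_right_half[OF P] by auto
    have "(cmod (sweep_val a J))\<^sup>2 = len P * (cmod (L2_inner (T (haar 0 P)) (haar 0 J)))\<^sup>2" if J: "J \<in> F" for J
    proof -
      have Jd: "J \<in> dyadic" and JP: "J \<subset> P" using J F half half_psubset[OF P] by auto
      then have "L2_inner (T (haar 0 P)) (haar 0 J) = sweep_val a J * complex_of_real (haar_val P J)"
        using matrix[OF P Jd] haar_val_eq_0[OF P Jd] by auto
      moreover have "(haar_val P J)\<^sup>2 = 1 / len P"
        using haar_val_sq[OF Jd P] JP by (simp add: power2_eq_square)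
      ultimately show ?thesis
        using len_pos[OF P] by (simp add: norm_mult power_mult_distrib)
    qed
    then have "(\<Sum>J\<in>F. (cmod (sweep_val a J))\<^sup>2) = len P * (\<Sum>J\<in>F. (cmod (L2_inner (T (haar 0 P)) (haar 0 J)))\<^sup>2)"
      by (simp add: sum_distrib_left)
    also have "\<dots> \<le> len P * C\<^sup>2"
      using haar_bessel[OF F(1), of "T (haar 0 P)"] F TL[OF P] T_le[OF P]
      by (intro mult_left_mono) (auto simp: subset_iff)
    finally show ?thesis by (simp add: lP power_mult_distrib mult_ac)
  qed
qed (use \<open>0 \<le> C\<close> in auto)

section \<open>The two-sided estimate of the operator norm\<close>

lemma op_norm_upper:
  "L2_op_norm (paraproduct a 1 1) \<le> ennreal 4 * (CM_norm (sweep a) + linf_norm (E_seq a))"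
proof (cases "CM_norm (sweep a) = \<infinity> \<or> linf_norm (E_seq a) = \<infinity>")
  case True
  then have "CM_norm (sweep a) + linf_norm (E_seq a) = \<infinity>" by auto
  then show ?thesis by (simp only:) (simp add: ennreal_mult_top)
next
  case False
  then obtain M N where MN: "CM_norm (sweep a) = ennreal M" "linf_norm (E_seq a) = ennreal N" "0 \<le> M" "0 \<le> N"
    by (cases "CM_norm (sweep a)"; cases "linf_norm (E_seq a)") auto
  interpret bounded_symbol a M N
    using MN by (intro bounded_symbol_if_norms_le) auto
  have "L2_op_norm (paraproduct a 1 1) \<le> ennreal (4 * M + N)"
    unfolding L2_op_norm_def using op_bounded_linear op_realizes MN
    by (intro Inf_lower CollectI exI[of _ "4 * M + N"]) auto
  \<comment> \<open>The diagonal costs only a factor 1; using 4 for both factors out the sum of the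
    norms.\<close>
  also have "\<dots> \<le> ennreal (4 * (M + N))"
    using MN by (intro ennreal_leI) auto
  also have "\<dots> = ennreal 4 * (CM_norm (sweep a) + linf_norm (E_seq a))"
    using MN by (simp add: ennreal_mult)
  finally show ?thesis .
qed

lemma op_norm_lower:
  "ennreal (1 / 5) * (CM_norm (sweep a) + linf_norm (E_seq a)) \<le> L2_op_norm (paraproduct a 1 1)"
  unfolding L2_op_norm_def
proof (rule Inf_greatest)
  fix x assume "x \<in> {ennreal C |C. 0 \<le> C \<and> (\<exists>T. L2_bounded_linear T C \<and> realizes T (paraproduct a 1 1))}"
  then obtain C T where C: "x = ennreal C" "0 \<le> C" "L2_bounded_linear T C" "realizes T (paraproduct a 1 1)"
    by blast
  interpret bounded_symbol a "sqrt 2 * C" C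
    using C by (intro bounded_symbol_if_realizes)
  have "sqrt 2 \<le> 2" by (rule real_le_lsqrt) auto
  then have sqrt2: "sqrt 2 * C \<le> 2 * C" using C(2) by (rule mult_right_mono)
  have "CM_norm (sweep a) + linf_norm (E_seq a) \<le> ennreal (sqrt 2 * C) + ennreal (sqrt 2 * C + C)"
    by (intro add_mono CM_norm_sweep_le linf_norm_E_le)
  also have "\<dots> = ennreal (sqrt 2 * C + (sqrt 2 * C + C))"
    using C(2) by (intro ennreal_plus[symmetric]) auto
  \<comment> \<open>Two multiples \<open>sqrt 2 * C\<close>, each at most \<open>2 * C\<close>, and
    one \<open>C\<close> give the constant 5.\<close>
  also have "\<dots> \<le> ennreal (5 * C)"
    using sqrt2 by (intro ennreal_leI) linarith
  finally have "ennreal (1 / 5) * (CM_norm (sweep a) + linf_norm (E_seq a)) \<le> ennreal (1 / 5) * ennreal (5 * C)"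
    by (rule mult_left_mono) simp
  also have "\<dots> = x"
    using C by (subst ennreal_mult[symmetric]) auto
  finally show "ennreal (1 / 5) * (CM_norm (sweep a) + linf_norm (E_seq a)) \<le> x" .
qed

theorem theorem1p3:
  shows "(\<forall>b d :: real set \<Rightarrow> complex.
            bounded_on_L2 (composition (paraproduct b 1 0) (paraproduct d 0 1)) \<longleftrightarrow>
              CM_norm (sweep (schur b d)) < \<infinity> \<and> linf_norm (E_seq (schur b d)) < \<infinity>)
    \<and> (\<exists>c C :: real. 0 < c \<and> c \<le> C \<and>
        (\<forall>b d :: real set \<Rightarrow> complex.
            L2_op_norm (composition (paraproduct b 1 0) (paraproduct d 0 1))
              = L2_op_norm (paraproduct (schur b d) 1 1)
          \<and> ennreal c * (CM_norm (sweep (schur b d)) + linf_norm (E_seq (schur b d)))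
              \<le> L2_op_norm (paraproduct (schur b d) 1 1)
          \<and> L2_op_norm (paraproduct (schur b d) 1 1)
              \<le> ennreal C * (CM_norm (sweep (schur b d)) + linf_norm (E_seq (schur b d)))))"
proof (rule conjI)
  show "\<forall>b d :: real set \<Rightarrow> complex.
      bounded_on_L2 (composition (paraproduct b 1 0) (paraproduct d 0 1)) \<longleftrightarrow>
        CM_norm (sweep (schur b d)) < \<infinity> \<and> linf_norm (E_seq (schur b d)) < \<infinity>"
  proof (intro allI)
    fix b d :: "real set \<Rightarrow> complex"
    let ?s = "CM_norm (sweep (schur b d)) + linf_norm (E_seq (schur b d))"
    let ?n = "L2_op_norm (paraproduct (schur b d) 1 1)"
    \<comment> \<open>A sum of extended nonnegative numbers is finite exactly when both summands
      are, so finiteness transfers through the two-sided estimate.\<close>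
    have "?n < \<infinity> \<longleftrightarrow> ?s < \<infinity>"
    proof
      assume "?n < \<infinity>"
      then have "ennreal (1 / 5) * ?s < \<infinity>"
        using op_norm_lower by (rule le_less_trans[rotated])
      then show "?s < \<infinity>" by (auto simp: ennreal_mult_less_top)
    next
      assume "?s < \<infinity>"
      then have "ennreal 4 * ?s < \<infinity>" by (auto simp: ennreal_mult_less_top)
      then show "?n < \<infinity>"
        using op_norm_upper by (rule le_less_trans[rotated])
    qed
    then show "bounded_on_L2 (composition (paraproduct b 1 0) (paraproduct d 0 1)) \<longleftrightarrow>
        CM_norm (sweep (schur b d)) < \<infinity> \<and> linf_norm (E_seq (schur b d)) < \<infinity>"
      by (simp add: composition_paraproduct bounded_on_L2_iff)
  qed
qed (rule exI[of _ "1 / 5"], rule exI[of _ 4],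
    simp only: composition_paraproduct op_norm_lower op_norm_upper, simp)

end
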